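(* Let $\Omega=\{(x,y)\in\mathbb{R}^2:x^2+y^2<1\}$, let $0<\alpha<\frac{\pi}{2}$, and let $I$ be the arc of the unit circle consisting of the points with polar angle $\phi\in[\frac{\pi}{2}-\alpha,\frac{\pi}{2}+\alpha]$. Let $\gamma\in L^2(\Omega)$ be such that $\gamma=0$ in a neighborhood of the endpoints of $I$. Let the linearized incomplete Dirichlet-to-Neumann operator ${\Lambda^{inc}_{1,\gamma}}'$ with data on $I$ be defined as in the context. Then $\gamma$ is uniquely determined by the values $$\left\{\langle{\Lambda^{inc}_{1,\gamma}}'f,g\rangle \;:\; f^e,g^e\in H^{1/2}(\partial\Omega)\right\}.$$
   Context: For a function $f$ on $I$, $f^e$ denotes its extension by zero to $\partial\Omega$. If $f^e\in H^{1/2}(\partial\Omega)$, let $u_{f,1}\in H^1(\Omega)$ be the solution of $\Delta u_{f,1}=0$ in $\Omega$ with $u_{f,1}=f$ on $I$ and $u_{f,1}=0$ on $\partial\Omega\setminus I$. The linearized incomplete Dirichlet-to-Neumann operator with data on $I$ is defined by $$\langle{\Lambda^{inc}_{1,\gamma}}'f,g\rangle:=\int_\Omega\gamma\,\nabla u_{f,1}\cdot\nabla u_{g,1}\,dx,\qquad f^e,g^e\in H^{1/2}(\partial\Omega).$$ *)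

theory Defs
  imports "HOL-Analysis.Analysis"
begin

section \<open>Square-integrable functions\<close>

definition L2 :: "'a measure \<Rightarrow> ('a \<Rightarrow> 'b::euclidean_space) \<Rightarrow> bool" where
  "L2 M f \<longleftrightarrow> f \<in> borel_measurable M \<and> integrable M (\<lambda>x. (norm (f x))\<^sup>2)"

definition L2_tendsto ::
  "'a measure \<Rightarrow> (nat \<Rightarrow> 'a \<Rightarrow> 'b::euclidean_space) \<Rightarrow> ('a \<Rightarrow> 'b) \<Rightarrow> bool" where
  "L2_tendsto M v u \<longleftrightarrow> (\<forall>n. L2 M (v n)) \<and> L2 M u \<and>
     (\<lambda>n. \<integral>x. (norm (v n x - u x))\<^sup>2 \<partial>M) \<longlonglongrightarrow> 0"


section \<open>Smooth functions and weak gradients\<close>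

text \<open>The predicate \<open>Ck_on\<close> is meant for open \<open>U\<close>; partial derivatives are taken in the
  directions of the standard basis.\<close>

primrec Ck_on :: "nat \<Rightarrow> 'a::euclidean_space set \<Rightarrow> ('a \<Rightarrow> real) \<Rightarrow> bool" where
  "Ck_on 0 U f \<longleftrightarrow> continuous_on U f"
| "Ck_on (Suc k) U f \<longleftrightarrow> f differentiable_on U \<and>
     (\<forall>b\<in>Basis. Ck_on k U (\<lambda>x. frechet_derivative f (at x) b))"

definition smooth_on :: "'a::euclidean_space set \<Rightarrow> ('a \<Rightarrow> real) \<Rightarrow> bool" where
  "smooth_on U f \<longleftrightarrow> (\<forall>k. Ck_on k U f)"

definition test_function :: "'a::euclidean_space set \<Rightarrow> ('a \<Rightarrow> real) \<Rightarrow> bool" where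
  "test_function U \<phi> \<longleftrightarrow> smooth_on UNIV \<phi> \<and>
     compact (closure {x. \<phi> x \<noteq> 0}) \<and> closure {x. \<phi> x \<noteq> 0} \<subseteq> U"

text \<open>\<open>H1_with_grad U u G\<close>: the function \<open>u\<close> belongs to \<open>H\<^sup>1(U)\<close> and \<open>G\<close> is (a representative of)
  its weak gradient.\<close>

definition H1_with_grad ::
  "'a::euclidean_space set \<Rightarrow> ('a \<Rightarrow> real) \<Rightarrow> ('a \<Rightarrow> 'a) \<Rightarrow> bool" where
  "H1_with_grad U u G \<longleftrightarrow> L2 (lebesgue_on U) u \<and> L2 (lebesgue_on U) G \<and>
     (\<forall>\<phi>. test_function U \<phi> \<longrightarrow> (\<forall>b\<in>Basis.
        (\<integral>x. u x * frechet_derivative \<phi> (at x) b \<partial>lebesgue_on U)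
          = - (\<integral>x. (G x \<bullet> b) * \<phi> x \<partial>lebesgue_on U)))"

text \<open>Weak form of \<open>\<Delta>u = 0\<close> for a function with weak gradient \<open>G\<close>; the integrand is
  \<open>\<nabla>\<phi> \<bullet> G\<close>.\<close>

definition weakly_harmonic_grad :: "'a::euclidean_space set \<Rightarrow> ('a \<Rightarrow> 'a) \<Rightarrow> bool" where
  "weakly_harmonic_grad U G \<longleftrightarrow>
     (\<forall>\<phi>. test_function U \<phi> \<longrightarrow>
        (\<integral>x. frechet_derivative \<phi> (at x) (G x) \<partial>lebesgue_on U) = 0)"


section \<open>The unit disc and its boundary\<close>

text \<open>The plane is identified with \<open>complex\<close>, \<open>(x, y)\<close> being \<open>Complex x y\<close>.  Functions on the unit
  circle are treated in the arc length parametrisation \<open>t \<mapsto> cis t\<close> by \<open>[-\<pi>, \<pi>]\<close>.\<close>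

abbreviation unit_disc :: "complex set" where
  "unit_disc \<equiv> ball 0 1"

abbreviation angle_measure :: "real measure" where
  "angle_measure \<equiv> lebesgue_on {-pi..pi}"

definition boundary_arc :: "real \<Rightarrow> complex set" where
  "boundary_arc \<alpha> = cis ` {pi/2 - \<alpha> .. pi/2 + \<alpha>}"

text \<open>The boundary space \<open>H\<^sup>1\<^sup>/\<^sup>2\<close>, given by finiteness of the Sobolev--Slobodeckij norm.\<close>

definition H_half_circle :: "(complex \<Rightarrow> real) \<Rightarrow> bool" where
  "H_half_circle h \<longleftrightarrow> L2 angle_measure (\<lambda>t. h (cis t)) \<and>
     integrable (angle_measure \<Otimes>\<^sub>M angle_measure)
       (\<lambda>(s, t). (h (cis s) - h (cis t))\<^sup>2 / (norm (cis s - cis t))\<^sup>2)"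

text \<open>The trace operator is the continuous extension to \<open>H\<^sup>1\<close>, with values in \<open>L\<^sup>2\<close> of the circle,
  of the restriction map on functions that are smooth up to the boundary.\<close>

definition has_trace :: "(complex \<Rightarrow> real) \<Rightarrow> (complex \<Rightarrow> complex) \<Rightarrow> (complex \<Rightarrow> real) \<Rightarrow> bool" where
  "has_trace u G h \<longleftrightarrow>
     (\<exists>v Dv. (\<forall>n. (\<exists>U. open U \<and> closure unit_disc \<subseteq> U \<and> smooth_on U (v n)) \<and>
                  H1_with_grad unit_disc (v n) (Dv n)) \<and>
        L2_tendsto (lebesgue_on unit_disc) v u \<and>
        L2_tendsto (lebesgue_on unit_disc) Dv G \<and>
        L2_tendsto angle_measure (\<lambda>n t. v n (cis t)) (\<lambda>t. h (cis t)))"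

text \<open>\<open>u\<close>, with weak gradient \<open>G\<close>, is the \<open>H\<^sup>1\<close> solution of the Dirichlet problem for the
  Laplacian in the unit disc with boundary values \<open>h\<close>.\<close>

definition dirichlet_solution ::
  "(complex \<Rightarrow> real) \<Rightarrow> (complex \<Rightarrow> real) \<Rightarrow> (complex \<Rightarrow> complex) \<Rightarrow> bool" where
  "dirichlet_solution h u G \<longleftrightarrow>
     H1_with_grad unit_disc u G \<and> weakly_harmonic_grad unit_disc G \<and> has_trace u G h"


section \<open>The linearized incomplete Dirichlet-to-Neumann operator\<close>

definition zero_ext :: "complex set \<Rightarrow> (complex \<Rightarrow> real) \<Rightarrow> complex \<Rightarrow> real" where
  "zero_ext I f = (\<lambda>x. if x \<in> I then f x else 0)"

text \<open>\<open>has_lin_dtn_value I \<gamma> f g c\<close>: the form of the operator with data on \<open>I\<close> is defined at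
  \<open>(f, g)\<close> and has the value \<open>c\<close>.  Here \<open>G\<close> and \<open>H\<close> are the gradients of the Dirichlet solutions
  for \<open>f\<close> and \<open>g\<close>, which are unique almost everywhere.  As \<open>G \<bullet> H\<close> is in general only
  integrable, the integral against a square-integrable \<open>\<gamma>\<close> need not exist for every pair
  \<open>(f, g)\<close>; a value is assigned only where it does, and not the default value of the Bochner
  integral.\<close>

definition has_lin_dtn_value ::
  "complex set \<Rightarrow> (complex \<Rightarrow> real) \<Rightarrow> (complex \<Rightarrow> real) \<Rightarrow> (complex \<Rightarrow> real) \<Rightarrow> real \<Rightarrow> bool" where
  "has_lin_dtn_value I \<gamma> f g c \<longleftrightarrow>
     (\<exists>u G v H. dirichlet_solution (zero_ext I f) u G \<and> dirichlet_solution (zero_ext I g) v H \<and>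
        has_bochner_integral (lebesgue_on unit_disc) (\<lambda>x. \<gamma> x * (G x \<bullet> H x)) c)"

text \<open>\<open>\<gamma>\<close> vanishes, almost everywhere, in a neighbourhood of the points of \<open>P\<close>.\<close>

definition vanishes_near :: "complex set \<Rightarrow> (complex \<Rightarrow> real) \<Rightarrow> bool" where
  "vanishes_near P \<gamma> \<longleftrightarrow>
     (\<exists>U. open U \<and> P \<subseteq> U \<and> (AE x in lebesgue_on unit_disc. x \<in> U \<longrightarrow> \<gamma> x = 0))"

end

theory Submission
  imports Defs "HOL-Complex_Analysis.Cauchy_Integral_Formula"
begin

text \<open>Map the disc conformally onto the upper half disc by \<open>p\<close>, the complement of the arc going to the
  diameter. For a polynomial \<open>P\<close> with real coefficients, \<open>Im (P p)\<close> is harmonic and vanishes off the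
  arc. Taking \<open>P' = p\<^sup>n (1 - p\<^sup>2)\<close> makes its gradient bounded up to the endpoints of the arc, so that it
  solves an admissible Dirichlet problem. For \<open>\<gamma> = \<gamma>1 - \<gamma>2\<close> the hypothesis becomes
  \<open>\<integral> \<gamma> w Re (p\<^sup>m cnj p\<^sup>n) = 0\<close> for all \<open>m\<close>, \<open>n\<close>, with a positive bounded weight \<open>w\<close>. The span of the
  functions \<open>Re (p\<^sup>m cnj p\<^sup>n)\<close> is an algebra separating the points of the closed half disc, so by
  Stone--Weierstrass \<open>\<gamma> w\<close> is orthogonal to all continuous functions.\<close>


section \<open>Weak derivatives\<close>

text \<open>The form pairs a merely square-integrable coefficient with a product of two gradients
  that is in general only integrable, so data with bounded gradients are sought: for them the value
  exists for both coefficients. The gradient of \<open>Im f\<close> is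
  \<open>\<i> * cnj (deriv f)\<close>, and two such gradients have inner product
  \<open>Re (deriv f * cnj (deriv g))\<close>. The choice of \<open>P'\<close> makes the derivative
  \<open>p^n * (1 - p^2) * p'\<close>; the factor \<open>(1 - p^2) * p'\<close>, common to all
  \<open>n\<close>, enters the products as its squared modulus, which is the weight. The origin of
  \<open>1 - p^2\<close>: the endpoints of the arc go to the corners -1 and 1, where a smooth
  boundary is bent to a right angle. At distance \<open>d\<close> from an endpoint, the distance of
  \<open>p\<close> from the corner is of order \<open>sqrt d\<close> and \<open>p'\<close> of order
  \<open>1 / sqrt d\<close>, so the factor compensates exactly. The half disc serves twice: its
  diameter is real, so real polynomials have imaginary part zero there, and it contains no two
  distinct conjugate points, which \<open>Re (p^m * cnj p^n)\<close> could not separate.\<close>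

lemma Ck_on_cong:
  assumes "open U" "\<And>x. x \<in> U \<Longrightarrow> f x = g x"
  shows "Ck_on k U f \<longleftrightarrow> Ck_on k U g"
  using assms(2)
proof (induction k arbitrary: f g)
  case 0
  then show ?case by (auto intro: continuous_on_cong)
next
  case (Suc k)
  have hd: "(f has_derivative D) (at x) \<longleftrightarrow> (g has_derivative D) (at x)" if "x \<in> U" for x D
    by (rule iffI; erule has_derivative_transform_within_open[OF _ assms(1) that])
      (simp_all add: Suc.prems)
  have "f differentiable_on U \<longleftrightarrow> g differentiable_on U"
    unfolding differentiable_on_eq_differentiable_at[OF assms(1)] differentiable_def
    using hd by blast
  moreover have "frechet_derivative f (at x) = frechet_derivative g (at x)" if "x \<in> U" for x
    using hd[OF that] by (simp add: frechet_derivative_def)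
  then have "Ck_on k U (\<lambda>x. frechet_derivative f (at x) b)
      \<longleftrightarrow> Ck_on k U (\<lambda>x. frechet_derivative g (at x) b)" for b
    by (intro Suc.IH) simp
  ultimately show ?case
    by simp
qed

section \<open>Smoothness of imaginary parts of holomorphic functions\<close>

lemma has_derivative_Im_holomorphic:
  assumes "f holomorphic_on U" "open U" "x \<in> U"
  shows "((\<lambda>z. Im (f z)) has_derivative (\<lambda>y. Im (deriv f x * y))) (at x)"
proof -
  have "(f has_field_derivative deriv f x) (at x)"
    using holomorphic_derivI[OF assms] .
  then have "(f has_derivative (*) (deriv f x)) (at x)"
    by (simp add: has_field_derivative_def)
  then show ?thesis
    by (rule has_derivative_Im)
qed

text \<open>The derivative of \<open>Im f\<close> in direction \<open>b\<close> is
  \<open>Im (deriv f * b)\<close>, again the imaginary part of a holomorphic function, so the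
  induction generalises over \<open>f\<close>. The formula holds on \<open>U\<close> only, whence
  the appeal to \<open>Ck_on_cong\<close>.\<close>

lemma smooth_on_Im_holomorphic:
  assumes "f holomorphic_on U" "open U"
  shows "smooth_on U (\<lambda>z. Im (f z))"
proof -
  have "Ck_on k U (\<lambda>z. Im (f z))" for k
    using assms(1)
  proof (induction k arbitrary: f)
    case 0
    then show ?case by (auto intro!: continuous_intros holomorphic_on_imp_continuous_on)
  next
    case (Suc k)
    note hd = has_derivative_Im_holomorphic[OF Suc.prems assms(2)]
    have "Ck_on k U (\<lambda>x. frechet_derivative (\<lambda>z. Im (f z)) (at x) b)" for b
    proof -
      have "Ck_on k U (\<lambda>x. Im (deriv f x * b))"
        by (intro Suc.IH holomorphic_intros holomorphic_deriv Suc.prems assms(2))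
      moreover have "frechet_derivative (\<lambda>z. Im (f z)) (at x) b = Im (deriv f x * b)" if "x \<in> U" for x
        by (simp only: frechet_derivative_at[OF hd[OF that], symmetric])
      ultimately show ?thesis
        by (subst Ck_on_cong[OF assms(2)]) assumption
    qed
    moreover have "(\<lambda>z. Im (f z)) differentiable_on U"
      unfolding differentiable_on_eq_differentiable_at[OF assms(2)] differentiable_def
      by (intro ballI exI) (rule hd)
    ultimately show ?case by simp
  qed
  then show ?thesis by (simp add: smooth_on_def)
qed

text \<open>By translation invariance the integral of every difference quotient of \<open>\<psi>\<close> vanishes.\<close>

lemma integral_directional_derivative_eq_0:
  fixes \<psi> :: "'a::euclidean_space \<Rightarrow> real"
  assumes deriv: "\<And>x. (\<psi> has_derivative D x) (at x)"
    and bound: "\<And>x. \<bar>D x b\<bar> \<le> C"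
    and supp: "\<And>x. x \<notin> cball 0 R \<Longrightarrow> \<psi> x = 0"
  shows "(\<integral>x. D x b \<partial>lborel) = 0"
proof -
  define t where "t n = inverse (real (Suc n))" for n
  have t0: "t n > 0" and t1: "t n \<le> 1" for n
    by (auto simp: t_def field_simps)
  have t_lim: "t \<longlonglongrightarrow> 0"
    unfolding t_def by (rule LIMSEQ_inverse_real_of_nat)
  define q where "q n x = (\<psi> (x + t n *\<^sub>R b) - \<psi> x) / t n" for n x
  have cont: "continuous_on UNIV \<psi>"
    using deriv by (meson continuous_at_imp_continuous_on has_derivative_continuous)
  have [measurable]: "\<psi> \<in> borel_measurable borel"
    using cont by (rule borel_measurable_continuous_onI)
  have int\<psi>: "integrable lborel \<psi>"
  proof -
    have "integrable lborel (\<lambda>x. indicator (cball 0 R) x *\<^sub>R \<psi> x)"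
      using borel_integrable_compact[of "cball 0 R" \<psi>] cont
      by (auto intro: continuous_on_subset)
    moreover have "(\<lambda>x. indicator (cball 0 R) x *\<^sub>R \<psi> x) = \<psi>"
      using supp by (auto simp: indicator_def fun_eq_iff)
    ultimately show ?thesis by simp
  qed
  have shift: "integrable lborel (\<lambda>x. \<psi> (x + c))" "(\<integral>x. \<psi> (x + c) \<partial>lborel) = (\<integral>x. \<psi> x \<partial>lborel)" for c
  proof -
    have "lborel = distr lborel borel ((+) c)"
      by (rule lborel_distr_plus[symmetric])
    then show "integrable lborel (\<lambda>x. \<psi> (x + c))" "(\<integral>x. \<psi> (x + c) \<partial>lborel) = (\<integral>x. \<psi> x \<partial>lborel)"
      using int\<psi> integrable_distr_eq[of "(+) c" lborel borel \<psi>]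
        integral_distr[of "(+) c" lborel borel \<psi>]
      by (simp_all add: add.commute)
  qed
  have line: "((\<lambda>s. \<psi> (x + s *\<^sub>R b)) has_real_derivative D (x + s *\<^sub>R b) b) (at s)" for x s
  proof -
    have "((\<lambda>s. \<psi> (x + s *\<^sub>R b)) has_derivative (\<lambda>h. D (x + s *\<^sub>R b) (h *\<^sub>R b))) (at s)"
      by (rule has_derivative_compose[OF _ deriv]) (auto intro!: derivative_eq_intros)
    moreover have "(\<lambda>h. D (x + s *\<^sub>R b) (h *\<^sub>R b)) = (*) (D (x + s *\<^sub>R b) b)"
      using linear_scale[OF has_derivative_linear[OF deriv[of "x + s *\<^sub>R b"]]] by (auto simp: mult.commute)
    ultimately show ?thesis
      by (simp add: has_field_derivative_def)
  qed
  have bound_q: "\<bar>q n x\<bar> \<le> C" for n x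
  proof -
    obtain s where "\<psi> (x + t n *\<^sub>R b) - \<psi> (x + 0 *\<^sub>R b) = (t n - 0) * D (x + s *\<^sub>R b) b"
      using MVT2[OF t0[of n], of "\<lambda>s. \<psi> (x + s *\<^sub>R b)" "\<lambda>s. D (x + s *\<^sub>R b) b"] line by blast
    then have "q n x = D (x + s *\<^sub>R b) b"
      using t0[of n] by (simp add: q_def)
    then show ?thesis using bound by simp
  qed
  have lim_q: "(\<lambda>n. q n x) \<longlonglongrightarrow> D x b" for x
  proof -
    have "((\<lambda>h. (\<psi> (x + h *\<^sub>R b) - \<psi> x) / h) \<longlongrightarrow> D x b) (at 0)"
      using line[of x 0] by (simp add: DERIV_def)
    moreover have "filterlim t (at 0) sequentially"
      using t_lim t0 by (auto simp: filterlim_at less_imp_neq[THEN not_sym])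
    ultimately show ?thesis
      unfolding q_def by (rule filterlim_compose)
  qed
  \<comment> \<open>Since \<open>t n \<le> 1\<close>, all difference quotients live in one common
    ball, and a constant on that ball is an integrable majorant.\<close>
  have supp_q: "q n x = 0" if "x \<notin> cball 0 (R + norm b)" for n x
  proof -
    have "norm (t n *\<^sub>R b) \<le> norm b"
      using t0[of n] t1[of n] mult_right_mono[of "t n" 1 "norm b"] by simp
    moreover have "norm x \<le> norm (x + t n *\<^sub>R b) + norm (t n *\<^sub>R b)"
      using norm_triangle_ineq4[of "x + t n *\<^sub>R b" "t n *\<^sub>R b"] by simp
    ultimately have "x + t n *\<^sub>R b \<notin> cball 0 R"
      using that by auto
    moreover have "x \<notin> cball 0 R"
      using that norm_ge_zero[of b] by (simp del: norm_ge_zero)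
    ultimately show ?thesis
      using supp by (simp add: q_def)
  qed
  have qm: "q n \<in> borel_measurable lborel" for n
    unfolding q_def by measurable
  have "(\<lambda>n. \<integral>x. q n x \<partial>lborel) \<longlonglongrightarrow> (\<integral>x. D x b \<partial>lborel)"
  proof (rule integral_dominated_convergence[where w = "\<lambda>x. indicator (cball 0 (R + norm b)) x *\<^sub>R C"])
    show "(\<lambda>x. D x b) \<in> borel_measurable lborel"
      by (rule borel_measurable_LIMSEQ_real[OF lim_q qm])
    show "integrable lborel (\<lambda>x::'a. indicator (cball 0 (R + norm b)) x *\<^sub>R C)"
      by (rule borel_integrable_compact) auto
    show "AE x in lborel. norm (q n x) \<le> indicator (cball 0 (R + norm b)) x *\<^sub>R C" for n
      using bound_q supp_q by (auto simp: indicator_def)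
  qed (use lim_q qm in auto)
  moreover have "(\<integral>x. q n x \<partial>lborel) = 0" for n
    unfolding q_def using shift[of "t n *\<^sub>R b"] int\<psi> by simp
  ultimately show ?thesis
    by (simp add: LIMSEQ_const_iff)
qed

lemma integrable_lebesgue_on_compact_support:
  fixes k :: "'a::euclidean_space \<Rightarrow> real"
  assumes "open U" "compact K" "K \<subseteq> U" "continuous_on U k" "\<And>x. x \<in> U - K \<Longrightarrow> k x = 0"
  shows "integrable (lebesgue_on U) k"
proof -
  have "integrable lborel (\<lambda>x. indicator K x *\<^sub>R k x)"
    using assms by (intro borel_integrable_compact) (auto intro: continuous_on_subset)
  then have "integrable lebesgue (\<lambda>x. indicator K x *\<^sub>R k x)"
    by (subst integrable_completion) (auto dest: borel_measurable_integrable)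
  moreover have "(\<lambda>x. indicator K x *\<^sub>R k x) = (\<lambda>x. indicator U x *\<^sub>R k x)"
    using assms by (auto simp: indicator_def fun_eq_iff)
  ultimately show ?thesis
    using assms(1) by (simp add: integrable_restrict_space)
qed

lemma test_function_facts:
  fixes \<phi> :: "'a::euclidean_space \<Rightarrow> real"
  assumes "test_function U \<phi>"
  shows "(\<phi> has_derivative frechet_derivative \<phi> (at x)) (at x)"
    and "b \<in> Basis \<Longrightarrow> continuous_on S (\<lambda>x. frechet_derivative \<phi> (at x) b)"
    and "continuous_on S \<phi>"
proof -
  have "Ck_on 1 UNIV \<phi>"
    using assms by (simp add: test_function_def smooth_on_def)
  then have d: "\<phi> differentiable_on UNIV"
    and c: "b \<in> Basis \<Longrightarrow> continuous_on UNIV (\<lambda>x. frechet_derivative \<phi> (at x) b)"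
    by auto
  show "(\<phi> has_derivative frechet_derivative \<phi> (at x)) (at x)"
    using d by (simp add: differentiable_on_def frechet_derivative_works)
  show "b \<in> Basis \<Longrightarrow> continuous_on S (\<lambda>x. frechet_derivative \<phi> (at x) b)"
    using c by (auto intro: continuous_on_subset)
  show "continuous_on S \<phi>"
    using differentiable_imp_continuous_on[OF d] by (auto intro: continuous_on_subset)
qed

text \<open>The product of \<open>v\<close> and \<open>\<phi>\<close>, extended by zero, is
  differentiable everywhere, because \<open>U\<close> and the complement of the support of
  \<open>\<phi>\<close> are open and cover the space. Its derivative in direction \<open>b\<close>
  therefore has integral zero. No control of \<open>v\<close> at the boundary of \<open>U\<close>
  enters.\<close>

lemma integration_by_parts_test_function:
  fixes v :: "'a::euclidean_space \<Rightarrow> real"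
  assumes U: "open U" and \<phi>: "test_function U \<phi>" and b: "b \<in> Basis"
    and v: "\<And>x. x \<in> U \<Longrightarrow> (v has_derivative v' x) (at x)"
    and v'_cont: "continuous_on U (\<lambda>x. v' x b)"
  shows "integrable (lebesgue_on U) (\<lambda>x. v x * frechet_derivative \<phi> (at x) b)"
    and "integrable (lebesgue_on U) (\<lambda>x. v' x b * \<phi> x)"
    and "(\<integral>x. v x * frechet_derivative \<phi> (at x) b \<partial>lebesgue_on U)
          = - (\<integral>x. v' x b * \<phi> x \<partial>lebesgue_on U)"
proof -
  define K where "K = closure {x. \<phi> x \<noteq> 0}"
  have K: "compact K" "K \<subseteq> U"
    using \<phi> by (auto simp: K_def test_function_def)
  note \<phi>' = test_function_facts[OF \<phi>]
  have \<phi>0: "\<phi> x = 0" if "x \<notin> K" for x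
    using that closure_subset[of "{x. \<phi> x \<noteq> 0}"] by (auto simp: K_def)
  have openK: "open (-K)"
    using compact_imp_closed[OF K(1)] by (rule open_Compl)
  have d\<phi>0: "frechet_derivative \<phi> (at x) = (\<lambda>_. 0)" if "x \<notin> K" for x
  proof -
    have "(\<phi> has_derivative (\<lambda>_. 0)) (at x)"
      by (rule has_derivative_transform_within_open[OF has_derivative_const[of 0] openK])
        (use that \<phi>0 in auto)
    then show ?thesis
      using frechet_derivative_at by fastforce
  qed
  have v_cont: "continuous_on U v"
    using v by (meson continuous_at_imp_continuous_on has_derivative_continuous)
  define D where "D x y = (if x \<in> U then v x * frechet_derivative \<phi> (at x) y + v' x y * \<phi> x else 0)" for x y
  have deriv: "((\<lambda>x. if x \<in> U then v x * \<phi> x else 0) has_derivative D x) (at x)" for x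
  proof (cases "x \<in> U")
    case True
    have "((\<lambda>x. v x * \<phi> x) has_derivative D x) (at x)"
      using has_derivative_mult[OF v[OF True] \<phi>'(1)[of x]] True by (simp add: D_def[abs_def])
    then show ?thesis
      by (rule has_derivative_transform_within_open[OF _ U True]) auto
  next
    case False
    have "((\<lambda>x. if x \<in> U then v x * \<phi> x else 0) has_derivative (\<lambda>_. 0)) (at x)"
      by (rule has_derivative_transform_within_open[OF has_derivative_const[of 0] openK])
        (use False K \<phi>0 in auto)
    then show ?thesis
      using False by (simp add: D_def[abs_def])
  qed
  have contD: "continuous_on U (\<lambda>x. D x b)"
  proof -
    have "continuous_on U (\<lambda>x. v x * frechet_derivative \<phi> (at x) b + v' x b * \<phi> x)"
      by (intro continuous_intros v_cont v'_cont \<phi>'(2,3) b)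
    then show ?thesis by (simp add: D_def cong: continuous_on_cong)
  qed
  have D0: "D x b = 0" if "x \<notin> K" for x
    using that \<phi>0 d\<phi>0 by (simp add: D_def)
  obtain C where C: "\<bar>D x b\<bar> \<le> C" for x
  proof -
    have "bounded ((\<lambda>x. D x b) ` K)"
      using K contD by (intro compact_imp_bounded compact_continuous_image)
        (auto intro: continuous_on_subset)
    then obtain C where "\<And>x. x \<in> K \<Longrightarrow> \<bar>D x b\<bar> \<le> C"
      by (auto simp: bounded_iff)
    then show ?thesis
      using D0 by (intro that[of "max C 0"]) (metis abs_zero max.coboundedI1 max.cobounded2)
  qed
  obtain R where R: "K \<subseteq> cball 0 R"
    using compact_imp_bounded[OF K(1)] unfolding bounded_iff by (metis mem_cball_0 subsetI)
  have "(\<integral>x. D x b \<partial>lborel) = 0"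
    by (rule integral_directional_derivative_eq_0[OF deriv C, where R = R])
      (use R \<phi>0 in \<open>metis mult_zero_right subsetD\<close>)
  moreover have int1: "integrable (lebesgue_on U) (\<lambda>x. v x * frechet_derivative \<phi> (at x) b)"
    using K d\<phi>0 by (intro integrable_lebesgue_on_compact_support[OF U K] continuous_intros v_cont \<phi>'(2) b) auto
  moreover have int2: "integrable (lebesgue_on U) (\<lambda>x. v' x b * \<phi> x)"
    using K \<phi>0 by (intro integrable_lebesgue_on_compact_support[OF U K] continuous_intros v'_cont \<phi>'(3)) auto
  \<comment> \<open>The passage from \<open>lborel\<close> to its completion requires Borel
    measurability, which comes from the continuity of \<open>D\<close> on the compact support
    \<open>K\<close>.\<close>
  moreover have "(\<integral>x. D x b \<partial>lborel) = (\<integral>x. D x b \<partial>lebesgue_on U)"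
  proof -
    have "(\<lambda>x. indicator U x *\<^sub>R D x b) = (\<lambda>x. D x b)"
      by (auto simp: D_def indicator_def)
    moreover have "(\<lambda>x. indicator K x *\<^sub>R D x b) = (\<lambda>x. D x b)"
      using D0 by (fastforce simp: indicator_def)
    moreover have "integrable lborel (\<lambda>x. indicator K x *\<^sub>R D x b)"
      using K contD by (intro borel_integrable_compact) (auto intro: continuous_on_subset)
    ultimately show ?thesis
      using U by (simp add: integral_restrict_space integral_completion borel_measurable_integrable)
  qed
  moreover have "(\<integral>x. D x b \<partial>lebesgue_on U)
      = (\<integral>x. v x * frechet_derivative \<phi> (at x) b + v' x b * \<phi> x \<partial>lebesgue_on U)"
    by (intro Bochner_Integration.integral_cong) (auto simp: D_def)
  ultimately show "integrable (lebesgue_on U) (\<lambda>x. v x * frechet_derivative \<phi> (at x) b)"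
    "integrable (lebesgue_on U) (\<lambda>x. v' x b * \<phi> x)"
    "(\<integral>x. v x * frechet_derivative \<phi> (at x) b \<partial>lebesgue_on U)
          = - (\<integral>x. v' x b * \<phi> x \<partial>lebesgue_on U)"
    by auto
qed

section \<open>Square integrability and convergence of bounded functions\<close>

lemma L2_bounded:
  fixes f :: "'a \<Rightarrow> 'b::euclidean_space"
  assumes "finite_measure M" "f \<in> borel_measurable M" "\<And>x. x \<in> space M \<Longrightarrow> norm (f x) \<le> C"
  shows "L2 M f"
  unfolding L2_def
proof
  show "integrable M (\<lambda>x. (norm (f x))\<^sup>2)"
    by (rule finite_measure.integrable_const_bound[OF assms(1), where B = "C\<^sup>2"])
      (use assms(2,3) in \<open>auto intro!: AE_I2 power_mono\<close>)
qed fact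

text \<open>Dominated convergence with the constant majorant \<open>(2 * C)^2\<close>. It yields all
  three limits in the definition of the trace: for the function, its gradient and its boundary
  values.\<close>

lemma L2_tendsto_bounded:
  fixes v :: "nat \<Rightarrow> 'a \<Rightarrow> 'b::euclidean_space"
  assumes fin: "finite_measure M"
    and meas: "\<And>n. v n \<in> borel_measurable M" "u \<in> borel_measurable M"
    and bound: "\<And>n x. x \<in> space M \<Longrightarrow> norm (v n x) \<le> C"
    and lim: "\<And>x. x \<in> space M \<Longrightarrow> (\<lambda>n. v n x) \<longlonglongrightarrow> u x"
  shows "L2_tendsto M v u"
proof -
  have u: "norm (u x) \<le> C" if "x \<in> space M" for x
    using lim[OF that] bound[OF that] by (intro Lim_norm_ubound[of sequentially]) auto
  have "(\<lambda>n. \<integral>x. (norm (v n x - u x))\<^sup>2 \<partial>M) \<longlonglongrightarrow> (\<integral>x. 0 \<partial>M)"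
  proof (rule integral_dominated_convergence[where w = "\<lambda>x. (2 * C)\<^sup>2"])
    show "integrable M (\<lambda>x. (2 * C)\<^sup>2)"
      using finite_measure.integrable_const[OF fin] .
    show "AE x in M. (\<lambda>n. (norm (v n x - u x))\<^sup>2) \<longlonglongrightarrow> 0"
    proof (rule AE_I2)
      fix x assume "x \<in> space M"
      from tendsto_power[OF tendsto_norm_zero[OF LIM_zero[OF lim[OF this]]], of 2]
      show "(\<lambda>n. (norm (v n x - u x))\<^sup>2) \<longlonglongrightarrow> 0" by simp
    qed
    show "AE x in M. norm ((norm (v n x - u x))\<^sup>2) \<le> (2 * C)\<^sup>2" for n
    proof (rule AE_I2)
      fix x assume "x \<in> space M"
      then have "norm (v n x - u x) \<le> 2 * C"
        using norm_triangle_ineq4[of "v n x" "u x"] u[of x] bound[of x n] by linarith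
      then show "norm ((norm (v n x - u x))\<^sup>2) \<le> (2 * C)\<^sup>2"
        using power_mono[of "norm (v n x - u x)" "2 * C" 2] by simp
    qed
  qed (use meas in measurable)
  then show ?thesis
    unfolding L2_tendsto_def
    using L2_bounded[OF fin meas(1) bound] L2_bounded[OF fin meas(2) u] by simp
qed


section \<open>Dirichlet solutions from holomorphic functions\<close>

text \<open>The vector \<open>\<i> * cnj w\<close> represents the linear functional
  \<open>Im (w * b)\<close>; for \<open>w = deriv f\<close> it is the gradient of
  \<open>Im f\<close>.\<close>

lemma inner_i_mult_cnj: "(\<i> * cnj w) \<bullet> b = Im (w * b)"
  by (simp add: inner_complex_def algebra_simps)

lemma inner_i_cnj_i_cnj: "(\<i> * cnj a) \<bullet> (\<i> * cnj b) = Re (a * cnj b)"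
  by (simp add: inner_complex_def)

lemma H1_with_grad_Im_holomorphic:
  assumes f: "f holomorphic_on U" and U: "open U" "bounded U"
    and bound: "\<And>z. z \<in> U \<Longrightarrow> norm (f z) \<le> C" "\<And>z. z \<in> U \<Longrightarrow> norm (deriv f z) \<le> B"
  shows "H1_with_grad U (\<lambda>z. Im (f z)) (\<lambda>z. \<i> * cnj (deriv f z))"
proof -
  have fin: "finite_measure (lebesgue_on U)"
    using U by (intro finite_measure_lebesgue_on bounded_set_imp_lmeasurable) auto
  have cont: "continuous_on U f" "continuous_on U (deriv f)"
    using f holomorphic_deriv[OF f U(1)] by (auto intro: holomorphic_on_imp_continuous_on)
  have sets: "U \<in> sets lebesgue"
    using U by simp
  have "L2 (lebesgue_on U) (\<lambda>z. Im (f z))"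
  proof (rule L2_bounded[OF fin])
    show "(\<lambda>z. Im (f z)) \<in> borel_measurable (lebesgue_on U)"
      by (intro continuous_imp_measurable_on_sets_lebesgue continuous_intros cont sets)
    show "norm (Im (f z)) \<le> C" if "z \<in> space (lebesgue_on U)" for z
      using bound(1)[of z] abs_Im_le_cmod[of "f z"] that by simp
  qed
  moreover have "L2 (lebesgue_on U) (\<lambda>z. \<i> * cnj (deriv f z))"
  proof (rule L2_bounded[OF fin])
    show "(\<lambda>z. \<i> * cnj (deriv f z)) \<in> borel_measurable (lebesgue_on U)"
      by (intro continuous_imp_measurable_on_sets_lebesgue continuous_intros cont sets)
    show "norm (\<i> * cnj (deriv f z)) \<le> B" if "z \<in> space (lebesgue_on U)" for z
      using bound(2)[of z] that by (simp add: norm_mult)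
  qed
  moreover have "(\<integral>x. Im (f x) * frechet_derivative \<phi> (at x) b \<partial>lebesgue_on U)
          = - (\<integral>x. ((\<i> * cnj (deriv f x)) \<bullet> b) * \<phi> x \<partial>lebesgue_on U)"
    if "test_function U \<phi>" "b \<in> Basis" for \<phi> and b :: complex
    unfolding inner_i_mult_cnj
    by (rule integration_by_parts_test_function(3)[OF U(1) that
          has_derivative_Im_holomorphic[OF f U(1)]]) (intro continuous_intros cont | assumption)+
  ultimately show ?thesis
    by (simp add: H1_with_grad_def)
qed

text \<open>One integration by parts in each basis direction leaves
  \<open>Im (deriv (deriv f) * b * b)\<close>, and the contributions of \<open>b = 1\<close> and
  \<open>b = \<i>\<close> cancel.\<close>

lemma weakly_harmonic_grad_Im_holomorphic:
  assumes f: "f holomorphic_on U" and U: "open U"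
  shows "weakly_harmonic_grad U (\<lambda>z. \<i> * cnj (deriv f z))"
  unfolding weakly_harmonic_grad_def
proof (intro allI impI)
  fix \<phi> assume \<phi>: "test_function U \<phi>"
  let ?d = "\<lambda>x. frechet_derivative \<phi> (at x)"
  have f': "deriv f holomorphic_on U" and cont: "continuous_on U (deriv (deriv f))"
    using holomorphic_deriv[OF _ U] f by (auto intro!: holomorphic_on_imp_continuous_on)
  have parts:
    "integrable (lebesgue_on U) (\<lambda>x. Im (deriv f x * b) * ?d x b)"
    "(\<integral>x. Im (deriv f x * b) * ?d x b \<partial>lebesgue_on U)
      = - (\<integral>x. Im (deriv (deriv f) x * b * b) * \<phi> x \<partial>lebesgue_on U)"
    if "b \<in> Basis" for b
  proof -
    have hd: "((\<lambda>z. Im (deriv f z * b)) has_derivative (\<lambda>y. Im (deriv (deriv f) x * y * b))) (at x)"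
      if "x \<in> U" for x
    proof -
      have "((\<lambda>z. deriv f z * b) has_derivative (\<lambda>y. deriv (deriv f) x * y * b)) (at x)"
        using holomorphic_derivI[OF f' U that]
        by (intro has_derivative_mult_left) (simp add: has_field_derivative_def)
      then show ?thesis by (rule has_derivative_Im)
    qed
    have "continuous_on U (\<lambda>x. Im (deriv (deriv f) x * b * b))"
      by (intro continuous_intros cont)
    note ibp = integration_by_parts_test_function[OF U \<phi> that hd this]
    show "integrable (lebesgue_on U) (\<lambda>x. Im (deriv f x * b) * ?d x b)"
      "(\<integral>x. Im (deriv f x * b) * ?d x b \<partial>lebesgue_on U)
      = - (\<integral>x. Im (deriv (deriv f) x * b * b) * \<phi> x \<partial>lebesgue_on U)"
      by (rule ibp; assumption)+
  qed
  have "?d x (\<i> * cnj (deriv f x)) = Im (deriv f x * 1) * ?d x 1 + Im (deriv f x * \<i>) * ?d x \<i>" for x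
  proof -
    have lin: "linear (?d x)"
      using test_function_facts(1)[OF \<phi>] by (rule has_derivative_linear)
    have "\<i> * cnj (deriv f x) = Im (deriv f x) *\<^sub>R 1 + Re (deriv f x) *\<^sub>R \<i>"
      by (simp add: complex_eq_iff)
    then show ?thesis
      by (simp add: linear_add[OF lin] linear_scale[OF lin])
  qed
  then have "(\<integral>x. ?d x (\<i> * cnj (deriv f x)) \<partial>lebesgue_on U)
      = (\<integral>x. Im (deriv f x * 1) * ?d x 1 \<partial>lebesgue_on U) + (\<integral>x. Im (deriv f x * \<i>) * ?d x \<i> \<partial>lebesgue_on U)"
    using parts(1)[of 1] parts(1)[of \<i>] by (simp only: Bochner_Integration.integral_add complex_Basis_1 complex_Basis_i)
  also have "\<dots> = - (\<integral>x. Im (deriv (deriv f) x) * \<phi> x \<partial>lebesgue_on U)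
      - (\<integral>x. - (Im (deriv (deriv f) x) * \<phi> x) \<partial>lebesgue_on U)"
    using parts(2)[of 1] parts(2)[of \<i>] by (simp add: mult.assoc)
  also have "\<dots> = 0"
    by simp
  finally show "(\<integral>x. ?d x (\<i> * cnj (deriv f x)) \<partial>lebesgue_on U) = 0" .
qed

text \<open>As \<open>f\<close> need not be smooth up to the circle, the trace is reached through
  the dilations \<open>F n z = f (r n * z)\<close>, holomorphic on a disc of radius
  \<open>inverse (r n) > 1\<close>. They converge pointwise, and the bounds on \<open>f\<close> and
  \<open>deriv f\<close> are inherited by them, which turns pointwise into mean-square
  convergence.\<close>

lemma dirichlet_solution_Im_holomorphic:
  assumes f: "f holomorphic_on unit_disc" "continuous_on (cball 0 1) f"
    and B: "\<And>z. z \<in> unit_disc \<Longrightarrow> norm (deriv f z) \<le> B"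
    and h: "\<And>t. h (cis t) = Im (f (cis t))"
  shows "dirichlet_solution h (\<lambda>z. Im (f z)) (\<lambda>z. \<i> * cnj (deriv f z))"
proof -
  obtain C where C: "norm (f z) \<le> C" if "z \<in> cball 0 1" for z
    using compact_imp_bounded[OF compact_continuous_image[OF f(2) compact_cball]]
    unfolding bounded_iff by blast
  have fin: "finite_measure (lebesgue_on unit_disc)" "finite_measure angle_measure"
    by (auto intro!: finite_measure_lebesgue_on)
  define r where "r n = real (Suc n) / real (Suc (Suc n))" for n
  have r: "0 < r n" "r n < 1" for n
    by (auto simp: r_def)
  have r_lim: "r \<longlonglongrightarrow> 1"
    unfolding r_def by (rule LIMSEQ_Suc[OF LIMSEQ_n_over_Suc_n])
  define F where "F n z = f (of_real (r n) * z)" for n z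
  have maps: "of_real (r n) * z \<in> unit_disc" if "z \<in> ball 0 (inverse (r n))" for n z
    using that r[of n] by (simp add: norm_mult field_simps)
  have maps1: "of_real (r n) * z \<in> unit_disc" if "z \<in> cball 0 1" for n z
  proof -
    have "r n * norm z \<le> r n"
      using that r[of n] by (simp add: mult_left_le)
    then have "r n * norm z < 1"
      using r(2)[of n] by (rule order_le_less_trans)
    then show ?thesis
      using r(1)[of n] by (simp add: norm_mult)
  qed
  have F_hol: "F n holomorphic_on ball 0 (inverse (r n))" for n
  proof -
    have "f \<circ> (\<lambda>z. of_real (r n) * z) holomorphic_on ball 0 (inverse (r n))"
      by (rule holomorphic_on_compose_gen[OF _ f(1)]) (use maps in \<open>auto intro!: holomorphic_intros\<close>)
    then show ?thesis
      by (simp add: F_def[abs_def] o_def)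
  qed
  have cball_sub: "cball 0 1 \<subseteq> ball (0::complex) (inverse (r n))" for n
  proof
    fix z :: complex
    assume "z \<in> cball 0 1"
    then have "norm z \<le> 1" by simp
    also have "1 < inverse (r n)"
      using r[of n] by (simp add: one_less_inverse)
    finally show "z \<in> ball 0 (inverse (r n))" by simp
  qed
  have F_disc: "F n holomorphic_on unit_disc" for n
    using F_hol by (rule holomorphic_on_subset) (use cball_sub ball_subset_cball in blast)
  have deriv_F: "deriv (F n) z = of_real (r n) * deriv f (of_real (r n) * z)" if "z \<in> unit_disc" for n z
  proof (rule DERIV_imp_deriv)
    have "(f has_field_derivative deriv f (of_real (r n) * z)) (at (of_real (r n) * z))"
      by (rule holomorphic_derivI[OF f(1)]) (use maps1 that in auto)
    moreover have "((*) (of_real (r n)) has_field_derivative of_real (r n)) (at z)"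
      by (rule DERIV_cmult_Id)
    ultimately have "((\<lambda>z. f (of_real (r n) * z)) has_field_derivative
        deriv f (of_real (r n) * z) * of_real (r n)) (at z)"
      by (rule DERIV_chain2)
    then show "(F n has_field_derivative of_real (r n) * deriv f (of_real (r n) * z)) (at z)"
      by (simp add: F_def[abs_def] mult.commute)
  qed
  have deriv_F_bound: "norm (deriv (F n) z) \<le> B" if "z \<in> unit_disc" for n z
  proof -
    have "norm (deriv (F n) z) = r n * norm (deriv f (of_real (r n) * z))"
      using r[of n] by (simp add: deriv_F[OF that] norm_mult)
    also have "\<dots> \<le> 1 * B"
      using r[of n] B[OF maps1[of z n]] that by (intro mult_mono) auto
    finally show ?thesis by simp
  qed
  have F_bound: "norm (F n z) \<le> C" if "z \<in> cball 0 1" for n z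
    using C[of "of_real (r n) * z"] maps1[OF that, of n] by (simp add: F_def)
  have to1: "(\<lambda>n. of_real (r n) * z) \<longlonglongrightarrow> z" for z :: complex
    using tendsto_mult[OF tendsto_of_real[OF r_lim] tendsto_const[of z]] by simp
  have F_lim: "(\<lambda>n. F n z) \<longlonglongrightarrow> f z" if "z \<in> cball 0 1" for z
    unfolding F_def
    by (rule continuous_on_tendsto_compose[OF f(2) to1]) (use that maps1 in \<open>auto intro!: always_eventually less_imp_le\<close>)
  have deriv_cont: "continuous_on unit_disc (deriv f)"
    using holomorphic_deriv[OF f(1)] by (auto intro: holomorphic_on_imp_continuous_on)
  have deriv_F_lim: "(\<lambda>n. deriv (F n) z) \<longlonglongrightarrow> deriv f z" if "z \<in> unit_disc" for z
  proof -
    have "(\<lambda>n. deriv f (of_real (r n) * z)) \<longlonglongrightarrow> deriv f z"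
      by (rule continuous_on_tendsto_compose[OF deriv_cont to1]) (use that maps1 in auto)
    from tendsto_mult[OF tendsto_of_real[OF r_lim] this] show ?thesis
      by (simp add: deriv_F[OF that])
  qed
  have meas: "(\<lambda>z. g z) \<in> borel_measurable (lebesgue_on unit_disc)" if "continuous_on unit_disc g"
    for g :: "complex \<Rightarrow> 'b::euclidean_space"
    by (intro continuous_imp_measurable_on_sets_lebesgue that) auto
  have meas_angle: "(\<lambda>t. g (cis t)) \<in> borel_measurable angle_measure" if "continuous_on (cball 0 1) g"
    for g :: "complex \<Rightarrow> real"
    by (intro continuous_imp_measurable_on_sets_lebesgue continuous_on_compose2[OF that] continuous_intros) auto
  have H1: "H1_with_grad unit_disc (\<lambda>z. Im (F n z)) (\<lambda>z. \<i> * cnj (deriv (F n) z))" for n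
    by (rule H1_with_grad_Im_holomorphic[OF F_disc, where C = C and B = B]) (use F_bound deriv_F_bound in auto)
  have "has_trace (\<lambda>z. Im (f z)) (\<lambda>z. \<i> * cnj (deriv f z)) h"
    unfolding has_trace_def
  proof (intro exI conjI allI)
    fix n
    show "open (ball (0::complex) (inverse (r n)))" by simp
    show "closure unit_disc \<subseteq> ball 0 (inverse (r n))"
      using cball_sub by simp
    show "smooth_on (ball 0 (inverse (r n))) (\<lambda>z. Im (F n z))"
      by (rule smooth_on_Im_holomorphic[OF F_hol]) simp
    show "H1_with_grad unit_disc (\<lambda>z. Im (F n z)) (\<lambda>z. \<i> * cnj (deriv (F n) z))"
      by (rule H1)
  next
    have cF: "continuous_on (cball 0 1) (F n)" "continuous_on unit_disc (deriv (F n))" for n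
      using continuous_on_subset[OF holomorphic_on_imp_continuous_on[OF F_hol] cball_sub]
        holomorphic_on_imp_continuous_on[OF holomorphic_deriv[OF F_disc]] by auto
    have cF': "continuous_on unit_disc (F n)" "continuous_on unit_disc f" for n
      using cF(1) f(2) by (auto intro: continuous_on_subset[OF _ ball_subset_cball])
    show "L2_tendsto (lebesgue_on unit_disc) (\<lambda>n z. Im (F n z)) (\<lambda>z. Im (f z))"
    proof (rule L2_tendsto_bounded[OF fin(1)])
      show "norm (Im (F n z)) \<le> C" if "z \<in> space (lebesgue_on unit_disc)" for n z
        using F_bound[of z n] abs_Im_le_cmod[of "F n z"] that by simp
      show "(\<lambda>n. Im (F n z)) \<longlonglongrightarrow> Im (f z)" if "z \<in> space (lebesgue_on unit_disc)" for z
        using that by (intro tendsto_intros F_lim) auto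
    qed (intro meas continuous_intros cF')+
    show "L2_tendsto (lebesgue_on unit_disc) (\<lambda>n z. \<i> * cnj (deriv (F n) z)) (\<lambda>z. \<i> * cnj (deriv f z))"
    proof (rule L2_tendsto_bounded[OF fin(1)])
      show "norm (\<i> * cnj (deriv (F n) z)) \<le> B" if "z \<in> space (lebesgue_on unit_disc)" for n z
        using deriv_F_bound[of z n] that by (simp add: norm_mult)
      show "(\<lambda>n. \<i> * cnj (deriv (F n) z)) \<longlonglongrightarrow> \<i> * cnj (deriv f z)"
        if "z \<in> space (lebesgue_on unit_disc)" for z
        using that by (intro tendsto_intros deriv_F_lim) auto
    qed (intro meas continuous_intros cF deriv_cont)+
    have "L2_tendsto angle_measure (\<lambda>n t. Im (F n (cis t))) (\<lambda>t. Im (f (cis t)))"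
    proof (rule L2_tendsto_bounded[OF fin(2)])
      show "norm (Im (F n (cis t))) \<le> C" for n t
        using F_bound[of "cis t" n] abs_Im_le_cmod[of "F n (cis t)"] by simp
      show "(\<lambda>n. Im (F n (cis t))) \<longlonglongrightarrow> Im (f (cis t))" for t
        by (intro tendsto_intros F_lim) auto
    qed (rule meas_angle; intro continuous_intros cF f)+
    then show "L2_tendsto angle_measure (\<lambda>n t. Im (F n (cis t))) (\<lambda>t. h (cis t))"
      by (simp add: h)
  qed
  moreover have "H1_with_grad unit_disc (\<lambda>z. Im (f z)) (\<lambda>z. \<i> * cnj (deriv f z))"
    by (rule H1_with_grad_Im_holomorphic[OF f(1), where C = C and B = B]) (use C B in auto)
  moreover have "weakly_harmonic_grad unit_disc (\<lambda>z. \<i> * cnj (deriv f z))"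
    by (rule weakly_harmonic_grad_Im_holomorphic[OF f(1)]) simp
  ultimately show ?thesis
    by (simp add: dirichlet_solution_def)
qed

lemma H_half_circle_lipschitz:
  assumes lip: "\<And>s t. \<bar>h (cis s) - h (cis t)\<bar> \<le> L * norm (cis s - cis t)"
  shows "H_half_circle h"
proof -
  have fin: "finite_measure angle_measure"
    by (auto intro!: finite_measure_lebesgue_on)
  \<comment> \<open>The antipodal points \<open>cis 0\<close> and \<open>cis pi\<close> are
    distinct, so the Lipschitz bound there forces the sign.\<close>
  have L: "L \<ge> 0"
    using order_trans[OF abs_ge_zero lip[of 0 pi]] by (simp add: zero_le_mult_iff)
  have cont: "continuous_on UNIV (\<lambda>t. h (cis t))"
    unfolding continuous_on_def
  proof
    fix t
    have "((\<lambda>s. h (cis s) - h (cis t)) \<longlongrightarrow> 0) (at t)"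
    proof (rule Lim_null_comparison)
      show "\<forall>\<^sub>F s in at t. norm (h (cis s) - h (cis t)) \<le> L * norm (cis s - cis t)"
        using lip by simp
      have "((\<lambda>s. L * norm (cis s - cis t)) \<longlongrightarrow> L * norm (cis t - cis t)) (at t)"
        by (intro tendsto_intros)
      then show "((\<lambda>s. L * norm (cis s - cis t)) \<longlongrightarrow> 0) (at t)" by simp
    qed
    then show "((\<lambda>s. h (cis s)) \<longlongrightarrow> h (cis t)) (at t within UNIV)"
      by (simp add: LIM_zero_iff)
  qed
  have meas: "(\<lambda>t. h (cis t)) \<in> borel_measurable angle_measure"
    using cont by (intro continuous_imp_measurable_on_sets_lebesgue) (auto intro: continuous_on_subset)
  have meas_cis: "cis \<in> borel_measurable angle_measure"
    by (intro continuous_imp_measurable_on_sets_lebesgue continuous_intros) auto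
  have "\<bar>h (cis t)\<bar> \<le> \<bar>h 1\<bar> + L * 2" for t
  proof -
    have "norm (cis t - cis 0) \<le> 2"
      using norm_triangle_ineq4[of "cis t" "cis 0"] by simp
    then have "L * norm (cis t - cis 0) \<le> L * 2"
      using L by (rule mult_left_mono)
    with lip[of t 0] show ?thesis by simp
  qed
  then have "L2 angle_measure (\<lambda>t. h (cis t))"
    by (intro L2_bounded[OF fin meas, where C = "\<bar>h 1\<bar> + L * 2"]) simp
  moreover have "integrable (angle_measure \<Otimes>\<^sub>M angle_measure)
       (\<lambda>(s, t). (h (cis s) - h (cis t))\<^sup>2 / (norm (cis s - cis t))\<^sup>2)"
  proof (rule finite_measure.integrable_const_bound[where B = "L\<^sup>2"])
    show "finite_measure (angle_measure \<Otimes>\<^sub>M angle_measure)"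
      by (rule finite_measure_pair_measure[OF fin fin])
    \<comment> \<open>Where the two boundary points coincide the quotient is 0/0, with value 0;
      elsewhere it is bounded by the square of the Lipschitz constant.\<close>
    have "norm ((h (cis s) - h (cis t))\<^sup>2 / (norm (cis s - cis t))\<^sup>2) \<le> L\<^sup>2" for s t
    proof (cases "cis s = cis t")
      case False
      have "(h (cis s) - h (cis t))\<^sup>2 \<le> (L * norm (cis s - cis t))\<^sup>2"
        using lip[of s t] L by (intro abs_le_square_iff[THEN iffD1]) (simp add: abs_mult)
      then show ?thesis
        using False by (simp add: divide_le_eq power_mult_distrib)
    qed simp
    then show "AE x in angle_measure \<Otimes>\<^sub>M angle_measure.
        norm (case x of (s, t) \<Rightarrow> (h (cis s) - h (cis t))\<^sup>2 / (norm (cis s - cis t))\<^sup>2) \<le> L\<^sup>2"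
      by (intro AE_I2) auto
    note [measurable] = measurable_compose[OF measurable_fst meas] measurable_compose[OF measurable_snd meas]
      measurable_compose[OF measurable_fst meas_cis] measurable_compose[OF measurable_snd meas_cis]
    show "(\<lambda>(s, t). (h (cis s) - h (cis t))\<^sup>2 / (norm (cis s - cis t))\<^sup>2)
        \<in> borel_measurable (angle_measure \<Otimes>\<^sub>M angle_measure)"
      unfolding case_prod_beta' by measurable
  qed
  ultimately show ?thesis
    by (simp add: H_half_circle_def)
qed


section \<open>Vanishing criteria\<close>

lemma integrable_mult_bounded:
  fixes f g :: "'a \<Rightarrow> real"
  assumes "integrable M f" "g \<in> borel_measurable M" "\<And>x. x \<in> space M \<Longrightarrow> \<bar>g x\<bar> \<le> C"
  shows "integrable M (\<lambda>x. f x * g x)"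
proof (rule Bochner_Integration.integrable_bound)
  show "integrable M (\<lambda>x. C * f x)"
    using assms(1) by simp
  show "(\<lambda>x. f x * g x) \<in> borel_measurable M"
    using assms(1,2) by measurable
  show "AE x in M. norm (f x * g x) \<le> norm (C * f x)"
  proof (rule AE_I2)
    fix x assume "x \<in> space M"
    from assms(3)[OF this] have "\<bar>g x\<bar> \<le> \<bar>C\<bar>" by simp
    then show "norm (f x * g x) \<le> norm (C * f x)"
      using mult_left_mono[of "\<bar>g x\<bar>" "\<bar>C\<bar>" "\<bar>f x\<bar>"] by (simp add: abs_mult mult.commute)
  qed
qed

text \<open>Continuous functions approximating \<open>sgn f\<close> almost everywhere turn the
  hypothesis into a vanishing integral of the absolute value of \<open>f\<close>.\<close>

lemma AE_eq_0_if_orthogonal_to_continuous: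
  fixes f :: "'a::euclidean_space \<Rightarrow> real"
  assumes S: "S \<in> sets lebesgue" and f: "integrable (lebesgue_on S) f"
    and orth: "\<And>h. continuous_on UNIV h \<Longrightarrow> (\<And>x. \<bar>h x\<bar> \<le> 1) \<Longrightarrow> (\<integral>x. f x * h x \<partial>lebesgue_on S) = 0"
  shows "AE x in lebesgue_on S. f x = 0"
proof -
  define F where "F x = (if x \<in> S then sgn (f x) else 0)" for x
  have fm: "f \<in> borel_measurable (lebesgue_on S)"
    using f by (rule borel_measurable_integrable)
  have "(\<lambda>x. if x \<in> S then f x else 0) \<in> borel_measurable lebesgue"
    using borel_measurable_if_I[OF fm S] .
  then have "(\<lambda>x. sgn (if x \<in> S then f x else 0)) \<in> borel_measurable lebesgue"
    by measurable
  moreover have "(\<lambda>x. sgn (if x \<in> S then f x else 0)) = F"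
    by (auto simp: F_def)
  ultimately have "F measurable_on UNIV"
    by (intro lebesgue_measurable_imp_measurable_on) auto
  then obtain N g where N: "negligible N" and g: "\<And>n. continuous_on UNIV (g n)"
    and lim: "\<And>x. x \<notin> N \<Longrightarrow> (\<lambda>n. g n x) \<longlonglongrightarrow> F x"
    unfolding measurable_on_def by auto
  \<comment> \<open>Clamping keeps continuity and the limit, as \<open>F\<close> has values in
    [-1, 1], and supplies the bound needed both for \<open>orth\<close> and for dominated
    convergence.\<close>
  define h where "h n x = max (-1) (min 1 (g n x))" for n x
  have h_cont: "continuous_on UNIV (h n)" for n
    unfolding h_def by (intro continuous_intros g)
  have h_bound: "\<bar>h n x\<bar> \<le> 1" for n x
    by (simp add: h_def abs_le_iff)
  have h_lim: "(\<lambda>n. h n x) \<longlonglongrightarrow> F x" if "x \<notin> N" for x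
  proof -
    have "(\<lambda>n. h n x) \<longlonglongrightarrow> max (-1) (min 1 (F x))"
      unfolding h_def by (intro tendsto_max tendsto_min tendsto_const lim that)
    moreover have "max (-1) (min 1 (F x)) = F x"
      by (auto simp: F_def sgn_if)
    ultimately show ?thesis by simp
  qed
  have hm: "h n \<in> borel_measurable (lebesgue_on S)" for n
    using h_cont by (intro continuous_imp_measurable_on_sets_lebesgue S) (auto intro: continuous_on_subset)
  have "AE x in lebesgue. x \<notin> N"
    using N by (simp add: negligible_iff_null_sets AE_not_in)
  then have AE_N: "AE x in lebesgue_on S. x \<notin> N"
    using S by (auto simp: AE_restrict_space_iff elim: eventually_mono)
  have "(\<lambda>n. \<integral>x. f x * h n x \<partial>lebesgue_on S) \<longlonglongrightarrow> (\<integral>x. \<bar>f x\<bar> \<partial>lebesgue_on S)"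
  proof (rule integral_dominated_convergence[where w = "\<lambda>x. \<bar>f x\<bar>"])
    have fF: "f x * F x = \<bar>f x\<bar>" if "x \<in> S" for x
      using that by (simp add: F_def sgn_if abs_if)
    show "AE x in lebesgue_on S. (\<lambda>n. f x * h n x) \<longlonglongrightarrow> \<bar>f x\<bar>"
      using AE_N AE_space[of "lebesgue_on S"]
    proof eventually_elim
      case (elim x)
      then show ?case
        using tendsto_mult[OF tendsto_const[of "f x"] h_lim[of x]] by (simp add: fF)
    qed
    show "AE x in lebesgue_on S. norm (f x * h n x) \<le> \<bar>f x\<bar>" for n
      using h_bound[of n] by (intro AE_I2) (simp add: abs_mult mult_left_le)
    show "integrable (lebesgue_on S) (\<lambda>x. \<bar>f x\<bar>)"
      using f by simp
  qed (use fm hm in measurable)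
  moreover have "(\<integral>x. f x * h n x \<partial>lebesgue_on S) = 0" for n
    by (rule orth[OF h_cont h_bound])
  ultimately have "(\<integral>x. \<bar>f x\<bar> \<partial>lebesgue_on S) = 0"
    by (simp add: LIMSEQ_const_iff)
  then show ?thesis
    using f by (simp add: integral_nonneg_eq_0_iff_AE)
qed


section \<open>Density on the half disc\<close>

definition half_disc :: "complex set" where
  "half_disc = cball 0 1 \<inter> {p. 0 \<le> Im p}"

text \<open>These are the real polynomials in \<open>Re p\<close> and \<open>(Im p)\<^sup>2\<close>.\<close>

inductive_set re_monomial_span :: "(complex \<Rightarrow> real) set" where
  monomial: "(\<lambda>p. Re (p ^ m * cnj p ^ n)) \<in> re_monomial_span"
| add: "P \<in> re_monomial_span \<Longrightarrow> Q \<in> re_monomial_span \<Longrightarrow> (\<lambda>p. P p + Q p) \<in> re_monomial_span"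
| scale: "P \<in> re_monomial_span \<Longrightarrow> (\<lambda>p. c * P p) \<in> re_monomial_span"

text \<open>On monomials this is \<open>2 * Re a * Re b = Re (a * b) + Re (a * cnj b)\<close>, where
  conjugating \<open>b\<close> swaps its two exponents. The rest is bilinearity, by induction on
  each factor.\<close>

lemma re_monomial_span_mult:
  assumes "P \<in> re_monomial_span" "Q \<in> re_monomial_span"
  shows "(\<lambda>p. P p * Q p) \<in> re_monomial_span"
  using assms(1)
proof induction
  case (monomial m n)
  show ?case
    using assms(2)
  proof induction
    case (monomial k l)
    have eq: "(\<lambda>p. Re (p ^ m * cnj p ^ n) * Re (p ^ k * cnj p ^ l)) =
        (\<lambda>p. 1/2 * (Re (p ^ (m + k) * cnj p ^ (n + l)) + Re (p ^ (m + l) * cnj p ^ (n + k))))"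
    proof
      fix p :: complex
      have *: "Re a * Re b = 1/2 * (Re (a * b) + Re (a * cnj b))" for a b
        by simp
      show "Re (p ^ m * cnj p ^ n) * Re (p ^ k * cnj p ^ l) =
        1/2 * (Re (p ^ (m + k) * cnj p ^ (n + l)) + Re (p ^ (m + l) * cnj p ^ (n + k)))"
        unfolding * by (simp only: complex_cnj_mult complex_cnj_power complex_cnj_cnj power_add mult_ac)
    qed
    show ?case
      unfolding eq by (intro re_monomial_span.intros)
  next
    case (add P Q)
    then show ?case
      using re_monomial_span.add by (simp add: distrib_left)
  next
    case (scale P c)
    then show ?case
      using re_monomial_span.scale by (simp add: mult.left_commute)
  qed
next
  case (add P Q)
  then show ?case
    using re_monomial_span.add by (simp add: distrib_right)
next
  case (scale P c)
  then show ?case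
    using re_monomial_span.scale by (simp add: mult.assoc)
qed

lemma continuous_on_re_monomial_span: "P \<in> re_monomial_span \<Longrightarrow> continuous_on S P"
  by (induction rule: re_monomial_span.induct) (auto intro!: continuous_intros)

lemma compact_half_disc: "compact half_disc"
  unfolding half_disc_def
  by (intro compact_Int_closed compact_cball closed_Collect_le continuous_intros)

text \<open>Points are separated by \<open>Re p\<close> or else by \<open>p * cnj p\<close>, hence
  by \<open>(Im p)^2\<close>, which determines \<open>Im p\<close> because \<open>half_disc\<close>
  has no point below the real axis. On the full disc density would fail, every member of the span
  being invariant under conjugation.\<close>

lemma re_monomial_span_dense:
  assumes "continuous_on half_disc g" "0 < \<epsilon>"
  shows "\<exists>P\<in>re_monomial_span. \<forall>p\<in>half_disc. \<bar>g p - P p\<bar> < \<epsilon>"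
proof -
  interpret function_ring_on re_monomial_span half_disc
  proof
    fix c :: real
    show "(\<lambda>_. c) \<in> re_monomial_span"
      using re_monomial_span.scale[OF re_monomial_span.monomial[of 0 0], of c] by simp
  next
    fix x y assume xy: "x \<in> half_disc" "y \<in> half_disc" "x \<noteq> y"
    show "\<exists>f\<in>re_monomial_span. f x \<noteq> f y"
    proof (cases "Re x = Re y")
      case False
      then show ?thesis
        by (intro bexI[OF _ re_monomial_span.monomial[of 1 0]]) simp
    next
      case True
      have "Re (x ^ 1 * cnj x ^ 1) \<noteq> Re (y ^ 1 * cnj y ^ 1)"
      proof
        assume "Re (x ^ 1 * cnj x ^ 1) = Re (y ^ 1 * cnj y ^ 1)"
        then have "(Im x)\<^sup>2 = (Im y)\<^sup>2"
          using True by (simp add: power2_eq_square)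
        then have "Im x = Im y"
          using xy(1,2) by (simp add: half_disc_def power2_eq_iff_nonneg)
        with True xy(3) show False
          by (simp add: complex_eq_iff)
      qed
      then show ?thesis
        by (rule bexI[OF _ re_monomial_span.monomial])
    qed
  qed (auto intro: compact_half_disc continuous_on_re_monomial_span re_monomial_span.add
      re_monomial_span_mult)
  show ?thesis
    by (rule Stone_Weierstrass_basic[OF assms])
qed


section \<open>The conformal map\<close>

text \<open>The conformal map \<open>half_map\<close> of the disc onto the upper half disc is the composition of a
  Moebius map onto the upper half plane, the square root, and a Moebius map of the right half plane
  onto the disc. It sends the arc \<open>{z. norm z = 1 \<and> Im z < Re e}\<close> to the diameter.\<close>

locale arc_param =
  fixes e :: complex
  assumes norm_e: "norm e = 1" and Im_e: "0 < Im e"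
begin

text \<open>For \<open>e = cis \<alpha>\<close> the zero \<open>\<i> * e\<close> and the pole
  \<open>\<i> * cnj e\<close> are the endpoints of the arc. The interior of the arc goes to the
  negative reals and its complement in the circle to the positive reals, so the square root puts
  these on the two edges of the first quadrant.\<close>

definition moebius :: "complex \<Rightarrow> complex" where
  "moebius z = (e + \<i> * z) / (1 + e * \<i> * z)"

definition half_map :: "complex \<Rightarrow> complex" where
  "half_map z = (csqrt (moebius z) - 1) / (csqrt (moebius z) + 1)"

text \<open>Undoing the three maps gives \<open>q = (1 + p) / (1 - p)\<close>, then
  \<open>q^2\<close>, then the inverse Moebius map. Clearing the denominator
  \<open>(1 - p)^2\<close> leaves a formula that is also regular at \<open>p = 1\<close>.\<close>

definition half_inv :: "complex \<Rightarrow> complex" where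
  "half_inv p = - \<i> * (e * (1 - p)\<^sup>2 - (1 + p)\<^sup>2) / (e * (1 + p)\<^sup>2 - (1 - p)\<^sup>2)"

text \<open>This is \<open>(1 - p^2) * p'\<close> for \<open>p = half_map z\<close>, with the factor
  \<open>csqrt (moebius z)\<close> cancelled.\<close>

definition weight :: "complex \<Rightarrow> complex" where
  "weight z = 4 * (\<i> * (1 - e\<^sup>2) / (1 + e * \<i> * z)\<^sup>2) / (csqrt (moebius z) + 1) ^ 4"

text \<open>The primitive of \<open>p\<^sup>n (1 - p\<^sup>2)\<close> at \<open>p = half_map z\<close>; the factor \<open>1 - p\<^sup>2\<close> cancels the
  singularities of the derivative of \<open>half_map\<close> at the endpoints of the arc.\<close>

definition potential :: "nat \<Rightarrow> complex \<Rightarrow> complex" where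
  "potential n z = half_map z ^ (n + 1) / of_nat (n + 1) - half_map z ^ (n + 3) / of_nat (n + 3)"

section \<open>Mapping properties of the conformal map and its inverse\<close>

lemma e_cnj: "e * cnj e = 1"
  using norm_e by (simp add: complex_norm_square[symmetric])

lemma e_sq: "e\<^sup>2 \<noteq> 1"
  using Im_e by (auto simp: power2_eq_1_iff)

lemma norm_right_half_plane:
  assumes "0 \<le> Re q"
  shows "1 \<le> norm (q + 1)" "norm q \<le> norm (q + 1)" "norm (q - 1) \<le> norm (q + 1)"
proof -
  show "1 \<le> norm (q + 1)"
    using abs_Re_le_cmod[of "q + 1"] assms by simp
  show "norm q \<le> norm (q + 1)" "norm (q - 1) \<le> norm (q + 1)"
    unfolding cmod_def using assms
    by (intro real_sqrt_le_mono; simp add: power2_eq_square algebra_simps)+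
qed

lemma csqrt_plus_1: "csqrt w + 1 \<noteq> 0" "1 \<le> norm (csqrt w + 1)" "norm (csqrt w) \<le> norm (csqrt w + 1)"
  using norm_right_half_plane[OF Re_csqrt[of w]] by auto

text \<open>Expanding by the conjugate of the denominator exhibits the signs: the imaginary part is
  positive in the disc and zero on the circle, where the real part has the sign of
  \<open>Re e - Im z\<close>. At the pole both sides are 0.\<close>

lemma moebius_eq:
  "moebius z = Complex ((1 + (norm z)\<^sup>2) * Re e - 2 * Im z) ((1 - (norm z)\<^sup>2) * Im e) / of_real ((norm (1 + e * \<i> * z))\<^sup>2)"
proof -
  have e: "Re e * Re e = 1 - Im e * Im e"
    using norm_e by (simp add: cmod_def power2_eq_square)
  have "(e + \<i> * z) * cnj (1 + e * \<i> * z) = e + \<i> * z - e * cnj e * \<i> * cnj z + cnj e * (z * cnj z)"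
    by (simp add: algebra_simps)
  also have "\<dots> = e + \<i> * z - \<i> * cnj z + cnj e * of_real ((norm z)\<^sup>2)"
    by (simp only: e_cnj complex_norm_square mult_1)
  also have "\<dots> = Complex ((1 + (norm z)\<^sup>2) * Re e - 2 * Im z) ((1 - (norm z)\<^sup>2) * Im e)"
    by (simp add: complex_eq_iff algebra_simps)
  finally show ?thesis
    unfolding moebius_def by (subst complex_div_cnj) (simp only: of_real_power)
qed

lemma Re_moebius: "Re (moebius z) = ((1 + (norm z)\<^sup>2) * Re e - 2 * Im z) / (norm (1 + e * \<i> * z))\<^sup>2"
  and Im_moebius: "Im (moebius z) = ((1 - (norm z)\<^sup>2) * Im e) / (norm (1 + e * \<i> * z))\<^sup>2"
  unfolding moebius_eq by (simp_all only: Re_divide_of_real Im_divide_of_real complex.sel)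

lemma denominator_disc: "z \<in> unit_disc \<Longrightarrow> 1 + e * \<i> * z \<noteq> 0"
proof
  assume z: "z \<in> unit_disc" and "1 + e * \<i> * z = 0"
  then have "e * \<i> * z = -1"
    by (metis add.commute add_eq_0_iff)
  then have "norm (e * \<i> * z) = 1" by simp
  with z norm_e show False by (simp add: norm_mult)
qed

lemma Im_moebius_pos:
  assumes "z \<in> unit_disc"
  shows "0 < Im (moebius z)"
proof -
  have "(norm z)\<^sup>2 < 1"
    using assms by (simp add: power_less_one_iff abs_square_less_1)
  then show ?thesis
    using Im_e denominator_disc[OF assms] by (simp add: Im_moebius)
qed

lemma moebius_not_nonpos: "z \<in> unit_disc \<Longrightarrow> moebius z \<notin> \<real>\<^sub>\<le>\<^sub>0"
  using Im_moebius_pos by (fastforce simp: complex_nonpos_Reals_iff)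

lemma csqrt_moebius_quadrant:
  assumes "z \<in> unit_disc"
  shows "0 < Im (csqrt (moebius z))"
proof -
  have "Im ((csqrt (moebius z))\<^sup>2) > 0"
    using Im_moebius_pos[OF assms] by simp
  then have "2 * Re (csqrt (moebius z)) * Im (csqrt (moebius z)) > 0"
    by (simp add: power2_eq_square del: power2_csqrt)
  then show ?thesis
    using Re_csqrt[of "moebius z"] by (simp add: zero_less_mult_iff)
qed

lemma half_map_in_half_disc:
  assumes "z \<in> unit_disc"
  shows "half_map z \<in> half_disc"
proof -
  let ?q = "csqrt (moebius z)"
  have "norm (?q - 1) \<le> norm (?q + 1)"
    by (rule norm_right_half_plane[OF Re_csqrt])
  then have "norm (half_map z) \<le> 1"
    using csqrt_plus_1[of "moebius z"] by (simp add: half_map_def norm_divide divide_le_eq)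
  moreover have "half_map z = (?q - 1) * cnj (?q + 1) / of_real ((norm (?q + 1))\<^sup>2)"
    unfolding half_map_def by (subst complex_div_cnj) (simp only: of_real_power)
  then have "Im (half_map z) = 2 * Im ?q / (norm (?q + 1))\<^sup>2"
    by (simp only: Im_divide_of_real) (simp add: algebra_simps)
  then have "0 \<le> Im (half_map z)"
    using csqrt_moebius_quadrant[OF assms] by simp
  ultimately show ?thesis
    by (simp add: half_disc_def)
qed

text \<open>The squares of \<open>1 - p\<close> and \<open>1 + p\<close> are \<open>c\<close> and
  \<open>c * q^2\<close> with the same \<open>c\<close>, which cancels and leaves the inverse
  Moebius map at \<open>q^2 = moebius z\<close>. Only this composition is used, to write a function
  on the disc as a function of \<open>half_map z\<close>.\<close>

lemma half_inv_half_map: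
  assumes z: "z \<in> unit_disc"
  shows "half_inv (half_map z) = z"
proof -
  define q where "q = csqrt (moebius z)"
  have q1: "q + 1 \<noteq> 0" and q2: "q\<^sup>2 = moebius z"
    by (simp_all add: q_def csqrt_plus_1)
  have p: "1 - half_map z = 2 / (q + 1)" "1 + half_map z = 2 * q / (q + 1)"
    using q1 by (simp_all add: half_map_def q_def[symmetric] field_simps)
  define c where "c = (2 / (q + 1))\<^sup>2"
  have c: "c \<noteq> 0" "(2 * q / (q + 1))\<^sup>2 = c * q\<^sup>2"
    using q1 by (simp_all add: c_def power_divide power_mult_distrib)
  have "half_inv (half_map z) = - \<i> * (e * c - c * q\<^sup>2) / (e * (c * q\<^sup>2) - c)"
    by (simp only: half_inv_def p c_def[symmetric] c)
  also have "\<dots> = - \<i> * (c * (e - q\<^sup>2)) / (c * (e * q\<^sup>2 - 1))"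
    by (simp add: algebra_simps)
  also have "\<dots> = - \<i> * (e - moebius z) / (e * moebius z - 1)"
    using c by (simp add: q2)
  also have "\<dots> = z"
  proof -
    let ?d = "1 + e * \<i> * z"
    have d: "?d \<noteq> 0" by (rule denominator_disc[OF z])
    have "e - moebius z = (e\<^sup>2 - 1) * \<i> * z / ?d" "e * moebius z - 1 = (e\<^sup>2 - 1) / ?d"
      using d by (simp_all add: moebius_def field_simps power2_eq_square)
    then have "- \<i> * (e - moebius z) / (e * moebius z - 1)
        = - \<i> * ((e\<^sup>2 - 1) * \<i> * z / ?d) / ((e\<^sup>2 - 1) / ?d)"
      by (simp only:)
    also have "\<dots> = z"
      using d e_sq by simp
    finally show ?thesis .
  qed
  finally show ?thesis .
qed

text \<open>Continuity is needed up to the boundary, since the approximation takes place on the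
  compact half disc. Apart from \<open>p = -1\<close>, a zero of the denominator would mean
  \<open>e = ((1 - p) / (1 + p))^2\<close>, whose imaginary part is not positive there.\<close>

lemma continuous_on_half_inv: "continuous_on half_disc half_inv"
proof -
  have "e * (1 + p)\<^sup>2 - (1 - p)\<^sup>2 \<noteq> 0" if p: "p \<in> half_disc" for p
  proof
    assume "e * (1 + p)\<^sup>2 - (1 - p)\<^sup>2 = 0"
    then have eq: "e * (1 + p)\<^sup>2 = (1 - p)\<^sup>2" by simp
    have p1: "1 + p \<noteq> 0"
    proof
      assume "1 + p = 0"
      then have "p = -1" by (simp add: add_eq_0_iff)
      then show False using eq by simp
    qed
    \<comment> \<open>Multiplying the equation by the square of \<open>cnj (1 + p)\<close> makes the
      coefficient of \<open>e\<close> positive, so that imaginary parts can be compared.\<close>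
    define X where "X = (norm (1 + p))\<^sup>2"
    have X: "of_real X = (1 + p) * cnj (1 + p)"
      unfolding X_def by (rule complex_norm_square)
    have "e * of_real (X\<^sup>2) = e * (1 + p)\<^sup>2 * (cnj (1 + p))\<^sup>2"
      by (simp only: X of_real_power power_mult_distrib mult.assoc)
    also have "\<dots> = ((1 - p) * cnj (1 + p))\<^sup>2"
      by (simp only: eq power_mult_distrib)
    also have "(1 - p) * cnj (1 + p) = Complex (1 - (norm p)\<^sup>2) (- 2 * Im p)"
      using cmod_power2[of p] by (simp add: complex_eq_iff power2_eq_square algebra_simps)
    finally have "Im (e * of_real (X\<^sup>2)) = Im ((Complex (1 - (norm p)\<^sup>2) (- 2 * Im p))\<^sup>2)"
      by (rule arg_cong)
    then have "Im e * X\<^sup>2 = - 4 * (Im p * (1 - (norm p)\<^sup>2))"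
      by (simp add: power2_eq_square[of "Complex _ _"])
    moreover have "0 < Im e * X\<^sup>2"
      using p1 Im_e by (simp add: X_def)
    moreover have "0 \<le> Im p * (1 - (norm p)\<^sup>2)"
      using p by (intro mult_nonneg_nonneg) (auto simp: half_disc_def power_le_one)
    ultimately show False by simp
  qed
  then show ?thesis
    unfolding half_inv_def by (intro continuous_intros) auto
qed

section \<open>Derivatives, the bound on the weight, and the potentials\<close>

lemma DERIV_moebius:
  assumes "1 + e * \<i> * z \<noteq> 0"
  shows "(moebius has_field_derivative \<i> * (1 - e\<^sup>2) / (1 + e * \<i> * z)\<^sup>2) (at z)"
  unfolding moebius_def[abs_def]
  by (rule derivative_eq_intros refl assms)+ (simp add: power2_eq_square algebra_simps)

lemma DERIV_half_map:
  assumes "1 + e * \<i> * z \<noteq> 0" "moebius z \<notin> \<real>\<^sub>\<le>\<^sub>0"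
  shows "(half_map has_field_derivative
    \<i> * (1 - e\<^sup>2) / (1 + e * \<i> * z)\<^sup>2 / (csqrt (moebius z) * (csqrt (moebius z) + 1)\<^sup>2)) (at z)"
proof -
  define q where "q = csqrt (moebius z)"
  define m where "m = \<i> * (1 - e\<^sup>2) / (1 + e * \<i> * z)\<^sup>2"
  have q: "q + 1 \<noteq> 0" "q \<noteq> 0"
    using assms(2) by (auto simp: q_def csqrt_plus_1)
  have "((\<lambda>z. csqrt (moebius z)) has_field_derivative inverse (2 * q) * m) (at z)"
    unfolding q_def m_def
    by (rule DERIV_chain2[OF has_field_derivative_csqrt[OF assms(2)] DERIV_moebius[OF assms(1)]])
  then have "(half_map has_field_derivative
      ((inverse (2 * q) * m - 0) * (q + 1) - (q - 1) * (inverse (2 * q) * m + 0)) / ((q + 1) * (q + 1))) (at z)"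
    unfolding half_map_def[abs_def] q_def
    by (intro DERIV_divide DERIV_diff DERIV_add DERIV_const csqrt_plus_1)
  also have "((inverse (2 * q) * m - 0) * (q + 1) - (q - 1) * (inverse (2 * q) * m + 0)) / ((q + 1) * (q + 1))
      = m / (q * (q + 1)\<^sup>2)"
    using q by (simp add: field_simps power2_eq_square)
  finally show ?thesis
    by (simp add: q_def m_def)
qed

text \<open>The two powers contribute \<open>p^n * p'\<close> and \<open>p^(n+2) * p'\<close>, with
  difference \<open>p^n * (1 - p^2) * p'\<close>. The hypotheses also admit points of the circle off
  the arc, where continuity is needed later.\<close>

lemma DERIV_potential:
  assumes "1 + e * \<i> * z \<noteq> 0" "moebius z \<notin> \<real>\<^sub>\<le>\<^sub>0"
  shows "(potential n has_field_derivative half_map z ^ n * weight z) (at z)"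
proof -
  define q where "q = csqrt (moebius z)"
  define m where "m = \<i> * (1 - e\<^sup>2) / (1 + e * \<i> * z)\<^sup>2"
  have q: "q + 1 \<noteq> 0" "q \<noteq> 0"
    using assms(2) by (auto simp: q_def csqrt_plus_1)
  have pow: "((\<lambda>z. half_map z ^ Suc k / of_nat (Suc k)) has_field_derivative half_map z ^ k * (m / (q * (q + 1)\<^sup>2))) (at z)"
    for k
  proof (rule DERIV_cong)
    show "((\<lambda>z. half_map z ^ Suc k / of_nat (Suc k)) has_field_derivative
        of_nat (Suc k) * (m / (q * (q + 1)\<^sup>2) * half_map z ^ (Suc k - Suc 0)) / of_nat (Suc k)) (at z)"
      using DERIV_half_map[OF assms] unfolding q_def m_def by (intro DERIV_cdivide DERIV_power)
  qed (simp del: of_nat_Suc)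
  have "(potential n has_field_derivative
      half_map z ^ n * (m / (q * (q + 1)\<^sup>2)) - half_map z ^ (n + 2) * (m / (q * (q + 1)\<^sup>2))) (at z)"
    using DERIV_diff[OF pow[of n] pow[of "n + 2"]]
    by (simp add: potential_def[abs_def] numeral_3_eq_3 add.commute)
  also have "half_map z ^ n * (m / (q * (q + 1)\<^sup>2)) - half_map z ^ (n + 2) * (m / (q * (q + 1)\<^sup>2))
      = half_map z ^ n * ((1 - (half_map z)\<^sup>2) * (m / (q * (q + 1)\<^sup>2)))"
    by (simp only: power_add left_diff_distrib right_diff_distrib mult_1 mult.assoc)
  also have "1 - (half_map z)\<^sup>2 = (1 - half_map z) * (1 + half_map z)"
    by (simp add: power2_eq_square algebra_simps)
  also have "1 - half_map z = 2 / (q + 1)"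
    using q by (simp add: half_map_def q_def[symmetric] field_simps)
  also have "1 + half_map z = 2 * q / (q + 1)"
    using q by (simp add: half_map_def q_def[symmetric] field_simps)
  also have "2 / (q + 1) * (2 * q / (q + 1)) = 4 * q / (q + 1)\<^sup>2"
    by (simp add: power2_eq_square)
  also have "4 * q / (q + 1)\<^sup>2 * (m / (q * (q + 1)\<^sup>2)) = weight z"
  proof -
    have "(q + 1) ^ 4 = (q + 1)\<^sup>2 * (q + 1)\<^sup>2"
      by (simp flip: power_add)
    then have "weight z = 4 * m / ((q + 1)\<^sup>2 * (q + 1)\<^sup>2)"
      by (simp only: weight_def q_def m_def)
    then show ?thesis
      using q by simp
  qed
  finally show ?thesis .
qed

text \<open>Geometrically \<open>a\<close> and \<open>b\<close> are the distances of
  \<open>z\<close> from the pole and the zero of \<open>moebius\<close>, and \<open>d\<close> is the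
  distance between these two, so \<open>d \<le> a + b\<close>. As \<open>k \<ge> 1\<close> and
  \<open>k^4 \<ge> (b / a)^2\<close>, the product \<open>a^2 * k^4\<close> dominates both
  \<open>a^2\<close> and \<open>b^2\<close>, hence \<open>d^2 / 4\<close>; the weight has modulus
  \<open>4 * d / (a^2 * k^4)\<close>.\<close>

lemma norm_weight:
  assumes "z \<in> unit_disc"
  shows "norm (weight z) \<le> 16 / norm (1 - e\<^sup>2)"
proof -
  define a where "a = norm (1 + e * \<i> * z)"
  define b where "b = norm (e + \<i> * z)"
  define k where "k = norm (csqrt (moebius z) + 1)"
  define d where "d = norm (1 - e\<^sup>2)"
  have a: "a > 0"
    using denominator_disc[OF assms] by (simp add: a_def)
  have d: "d > 0"
    using e_sq by (auto simp: d_def)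
  have "1 - e\<^sup>2 = (1 + e * \<i> * z) - e * (e + \<i> * z)"
    by (simp add: power2_eq_square algebra_simps)
  then have "d \<le> a + norm (e * (e + \<i> * z))"
    unfolding d_def a_def by (simp only: norm_triangle_ineq4)
  then have ab: "d \<le> a + b"
    using norm_e by (simp add: b_def norm_mult)
  have "1 \<le> k ^ 4"
    using csqrt_plus_1(2)[of "moebius z"] by (simp add: k_def)
  then have 1: "a\<^sup>2 \<le> a\<^sup>2 * k ^ 4"
    using mult_left_mono[of 1 "k ^ 4" "a\<^sup>2"] by simp
  have "norm (csqrt (moebius z)) ^ 4 = (norm ((csqrt (moebius z))\<^sup>2))\<^sup>2"
    by (simp only: norm_power flip: power_mult) simp
  also have "\<dots> = (b / a)\<^sup>2"
    by (simp add: moebius_def norm_divide a_def b_def)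
  finally have "(b / a)\<^sup>2 \<le> k ^ 4"
    using power_mono[OF csqrt_plus_1(3)[of "moebius z"], of 4] by (simp add: k_def)
  then have "a\<^sup>2 * (b / a)\<^sup>2 \<le> a\<^sup>2 * k ^ 4"
    by (rule mult_left_mono) simp
  then have 2: "b\<^sup>2 \<le> a\<^sup>2 * k ^ 4"
    using a by (simp add: power_divide)
  have "d\<^sup>2 \<le> (a + b)\<^sup>2"
    using ab d by (intro power_mono) auto
  also have "\<dots> \<le> 2 * a\<^sup>2 + 2 * b\<^sup>2"
    using zero_le_power2[of "a - b"] by (simp add: power2_eq_square algebra_simps)
  also have "\<dots> \<le> 4 * (a\<^sup>2 * k ^ 4)"
    using 1 2 by simp
  finally have d2: "d\<^sup>2 \<le> 4 * (a\<^sup>2 * k ^ 4)" .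
  then have pos: "0 < a\<^sup>2 * k ^ 4"
    using d zero_less_power2[of d] by linarith
  have "norm (weight z) = 4 * d / (a\<^sup>2 * k ^ 4)"
    by (simp add: weight_def norm_mult norm_divide norm_power a_def d_def k_def)
  also have "\<dots> \<le> 16 / d"
    using pos d d2 by (simp add: field_simps power2_eq_square)
  finally show ?thesis
    by (simp add: d_def)
qed

lemma weight_nonzero: "z \<in> unit_disc \<Longrightarrow> weight z \<noteq> 0"
  using denominator_disc[of z] e_sq by (auto simp: weight_def csqrt_plus_1)

lemma continuous_on_half_map: "continuous_on unit_disc half_map"
  using DERIV_half_map[OF denominator_disc moebius_not_nonpos]
  by (intro continuous_at_imp_continuous_on ballI DERIV_isCont) blast

lemma continuous_on_moebius: "continuous_on unit_disc moebius"
  using DERIV_moebius[OF denominator_disc]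
  by (intro continuous_at_imp_continuous_on ballI DERIV_isCont) blast

lemma continuous_on_weight: "continuous_on unit_disc weight"
  unfolding weight_def[abs_def]
  by (intro continuous_intros continuous_on_compose2[OF continuous_on_csqrt continuous_on_moebius] ballI)
    (auto simp: csqrt_plus_1 denominator_disc moebius_not_nonpos)

lemma potential_extends:
  obtains f B where "f holomorphic_on unit_disc" "B-lipschitz_on (cball 0 1) f"
    "\<And>z. z \<in> unit_disc \<Longrightarrow> deriv f z = half_map z ^ n * weight z"
    "\<And>z. z \<in> unit_disc \<Longrightarrow> norm (deriv f z) \<le> B"
    "\<And>z. norm z = 1 \<Longrightarrow> Im z < Re e \<Longrightarrow> Im (f z) = 0"
proof -
  define B where "B = 16 / norm (1 - e\<^sup>2)"
  note D = DERIV_potential[OF denominator_disc moebius_not_nonpos, of _ n]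
  have bound: "norm (half_map z ^ n * weight z) \<le> B" if "z \<in> unit_disc" for z
  proof -
    have "norm (half_map z) ^ n \<le> 1"
      using half_map_in_half_disc[OF that] by (intro power_le_one) (auto simp: half_disc_def)
    then have "norm (half_map z) ^ n * norm (weight z) \<le> 1 * B"
      using norm_weight[OF that] by (intro mult_mono) (auto simp: B_def)
    then show ?thesis
      by (simp add: norm_mult norm_power)
  qed
  have "B-lipschitz_on unit_disc (potential n)"
  proof (rule lipschitz_onI)
    fix x y :: complex assume xy: "x \<in> unit_disc" "y \<in> unit_disc"
    show "dist (potential n x) (potential n y) \<le> B * dist x y"
      unfolding dist_norm
      by (rule field_differentiable_bound[OF convex_ball DERIV_subset[OF D] bound xy]) auto
  qed (simp add: B_def)
  \<comment> \<open>Boundary values come from the Lipschitz extension and not from the formula for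
    \<open>potential\<close>: on the arc \<open>moebius\<close> meets the branch cut of
    \<open>csqrt\<close>, and at its pole it takes the default value 0.\<close>
  then obtain f where f: "B-lipschitz_on (closure unit_disc) f" and f_eq: "\<And>z. z \<in> unit_disc \<Longrightarrow> f z = potential n z"
    using lipschitz_extend_closure by blast
  have f_lip: "B-lipschitz_on (cball 0 1) f"
    using f by simp
  have fD: "(f has_field_derivative half_map z ^ n * weight z) (at z)" if "z \<in> unit_disc" for z
    by (rule has_field_derivative_transform_within_open[OF D[OF that that] open_ball that]) (simp add: f_eq)
  show ?thesis
  proof (rule that[OF _ f_lip])
    show "f holomorphic_on unit_disc"
      unfolding holomorphic_on_open[OF open_ball] using fD by blast
    show deriv: "deriv f z = half_map z ^ n * weight z" if "z \<in> unit_disc" for z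
      using fD[OF that] by (rule DERIV_imp_deriv)
    show "norm (deriv f z) \<le> B" if "z \<in> unit_disc" for z
      using bound[OF that] deriv[OF that] by simp
    show "Im (f z) = 0" if z: "norm z = 1" "Im z < Re e" for z
    proof -
      \<comment> \<open>The denominator vanishes only at \<open>\<i> * cnj e\<close>, whose
        imaginary part is exactly \<open>Re e\<close>.\<close>
      have d: "1 + e * \<i> * z \<noteq> 0"
      proof
        assume "1 + e * \<i> * z = 0"
        then have "cnj e * (1 + e * \<i> * z) = 0" by simp
        then have "cnj e + e * cnj e * \<i> * z = 0" by (simp add: algebra_simps)
        then have "Re (cnj e + \<i> * z) = 0" unfolding e_cnj by simp
        with z show False by simp
      qed
      \<comment> \<open>Off the arc \<open>moebius z\<close> is a positive real, away from the
        branch cut, so the formula is continuous at \<open>z\<close>, agrees with the extension and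
        takes a real value.\<close>
      have re: "0 < Re (moebius z)"
        using d z by (simp add: Re_moebius)
      have im: "Im (moebius z) = 0"
        using z by (simp add: Im_moebius)
      have "moebius z \<notin> \<real>\<^sub>\<le>\<^sub>0"
        using re by (simp add: complex_nonpos_Reals_iff)
      then have "isCont (potential n) z"
        using DERIV_potential[OF d] DERIV_isCont by blast
      obtain x where x: "\<And>k. x k \<in> unit_disc" "x \<longlonglongrightarrow> z"
        using z(1) closure_sequential[of z unit_disc] by auto
      have "(\<lambda>k. potential n (x k)) \<longlonglongrightarrow> potential n z"
        using \<open>isCont (potential n) z\<close> x(2) by (rule isCont_tendsto_compose)
      moreover have "(\<lambda>k. f (x k)) \<longlonglongrightarrow> f z"
        by (rule continuous_on_tendsto_compose[OF lipschitz_on_continuous_on[OF f_lip] x(2)])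
          (use z(1) x(1) in \<open>auto intro!: always_eventually less_imp_le\<close>)
      ultimately have "f z = potential n z"
        using x(1) by (simp add: f_eq LIMSEQ_unique)
      moreover have "csqrt (moebius z) \<in> \<real>"
        using re im by simp
      then have "half_map z \<in> \<real>"
        unfolding half_map_def by (intro Reals_divide Reals_diff Reals_add Reals_1)
      then have "potential n z \<in> \<real>"
        unfolding potential_def by (intro Reals_diff Reals_divide Reals_power Reals_of_nat)
      ultimately show ?thesis
        by (simp add: complex_is_Real_iff)
    qed
  qed
qed

text \<open>The weight is absorbed into \<open>w\<close>, integrable because the weight is bounded,
  and removed at the end because it has no zero in the disc. Between, orthogonality to the monomials
  in \<open>half_map\<close> is carried over to all bounded continuous functions.\<close>

lemma AE_eq_0_if_moments_eq_0:
  assumes \<gamma>: "integrable (lebesgue_on unit_disc) \<gamma>"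
    and moments: "\<And>m n. (\<integral>z. \<gamma> z * ((norm (weight z))\<^sup>2 * Re (half_map z ^ m * cnj (half_map z) ^ n))
      \<partial>lebesgue_on unit_disc) = 0"
  shows "AE z in lebesgue_on unit_disc. \<gamma> z = 0"
proof -
  let ?M = "lebesgue_on unit_disc"
  define w where "w z = \<gamma> z * (norm (weight z))\<^sup>2" for z
  have meas: "g \<in> borel_measurable ?M" if "continuous_on unit_disc g" for g :: "complex \<Rightarrow> real"
    by (intro continuous_imp_measurable_on_sets_lebesgue that) auto
  have w: "integrable ?M w"
    unfolding w_def
  proof (rule integrable_mult_bounded[OF \<gamma>])
    show "(\<lambda>z. (norm (weight z))\<^sup>2) \<in> borel_measurable ?M"
      by (intro meas continuous_intros continuous_on_weight)
    show "\<bar>(norm (weight z))\<^sup>2\<bar> \<le> (16 / norm (1 - e\<^sup>2))\<^sup>2" if "z \<in> space ?M" for z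
      using norm_weight[of z] that by (simp add: power_mono del: power_divide)
  qed
  have span_int: "integrable ?M (\<lambda>z. w z * P (half_map z))" if "P \<in> re_monomial_span" for P
  proof -
    have "bounded (P ` half_disc)"
      using that by (intro compact_imp_bounded compact_continuous_image compact_half_disc continuous_on_re_monomial_span)
    then obtain C where "\<And>p. p \<in> half_disc \<Longrightarrow> \<bar>P p\<bar> \<le> C"
      by (auto simp: bounded_iff)
    then show ?thesis
      using half_map_in_half_disc
      by (intro integrable_mult_bounded[OF w, where C = C] meas
          continuous_on_compose2[OF continuous_on_re_monomial_span[OF that] continuous_on_half_map, of UNIV]) auto
  qed
  have span_zero: "(\<integral>z. w z * P (half_map z) \<partial>?M) = 0" if "P \<in> re_monomial_span" for P
    using that
  proof induction
    case (monomial m n)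
    then show ?case
      using moments[of m n] by (simp add: w_def mult.assoc)
  next
    case (add P Q)
    then show ?case
      using span_int by (simp add: distrib_left)
  next
    case (scale P c)
    then show ?case
      by (simp add: mult.left_commute)
  qed
  have "AE z in ?M. w z = 0"
  proof (rule AE_eq_0_if_orthogonal_to_continuous[OF _ w])
    fix h :: "complex \<Rightarrow> real"
    assume h: "continuous_on UNIV h" "\<And>z. \<bar>h z\<bar> \<le> 1"
    have hm: "h \<in> borel_measurable ?M"
      using h(1) by (intro meas) (auto intro: continuous_on_subset)
    have wh: "integrable ?M (\<lambda>z. w z * h z)"
      using integrable_mult_bounded[OF w hm h(2)] .
    have "\<bar>\<integral>z. w z * h z \<partial>?M\<bar> \<le> \<epsilon> * (\<integral>z. \<bar>w z\<bar> \<partial>?M)" if eps: "\<epsilon> > 0" for \<epsilon>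
    proof -
      \<comment> \<open>The test function is transplanted to the half disc, approximated there, and
        pulled back by \<open>half_map\<close>.\<close>
      have "continuous_on half_disc (\<lambda>p. h (half_inv p))"
        by (rule continuous_on_compose2[OF h(1) continuous_on_half_inv]) simp
      then obtain P where P: "P \<in> re_monomial_span"
        and approx: "\<And>p. p \<in> half_disc \<Longrightarrow> \<bar>h (half_inv p) - P p\<bar> < \<epsilon>"
        using re_monomial_span_dense[OF _ eps] by blast
      have "(\<integral>z. w z * h z \<partial>?M) = (\<integral>z. w z * h z - w z * P (half_map z) \<partial>?M)"
        using wh span_int[OF P] span_zero[OF P] by simp
      also have "\<bar>\<dots>\<bar> \<le> (\<integral>z. \<epsilon> * \<bar>w z\<bar> \<partial>?M)"
      proof (rule order_trans[OF integral_abs_bound integral_mono])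
        fix z assume "z \<in> space ?M"
        then have z: "z \<in> unit_disc" by simp
        have "\<bar>h z - P (half_map z)\<bar> \<le> \<epsilon>"
          using approx[OF half_map_in_half_disc[OF z]] half_inv_half_map[OF z] by simp
        then have "\<bar>w z\<bar> * \<bar>h z - P (half_map z)\<bar> \<le> \<bar>w z\<bar> * \<epsilon>"
          by (rule mult_left_mono) simp
        then show "\<bar>w z * h z - w z * P (half_map z)\<bar> \<le> \<epsilon> * \<bar>w z\<bar>"
          by (simp only: right_diff_distrib[symmetric] abs_mult mult.commute[of \<epsilon>])
      qed (use wh span_int[OF P] w in auto)
      finally show ?thesis by simp
    qed
    note le = this
    define I where "I = (\<integral>z. \<bar>w z\<bar> \<partial>?M)"
    have I: "0 \<le> I" by (simp add: I_def)
    show "(\<integral>z. w z * h z \<partial>?M) = 0"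
    proof (rule ccontr)
      assume nz: "(\<integral>z. w z * h z \<partial>?M) \<noteq> 0"
      define a where "a = \<bar>\<integral>z. w z * h z \<partial>?M\<bar>"
      have a: "a > 0" using nz by (simp add: a_def)
      \<comment> \<open>The estimate is used with \<open>\<epsilon> = a / (2 * (I + 1))\<close>; the
        summand 1 keeps the denominator positive even if \<open>I = 0\<close>.\<close>
      have "a \<le> a / (2 * (I + 1)) * I"
      proof -
        have "0 < a / (2 * (I + 1))"
          using a I by simp
        from le[OF this] show ?thesis
          unfolding a_def[symmetric] I_def[symmetric] .
      qed
      also have "\<dots> < a"
        using a I by (simp add: field_simps) (smt (verit) mult_nonneg_nonneg)
      finally show False by simp
    qed
  qed simp
  then show ?thesis
    using AE_space[of ?M]
  proof eventually_elim
    case (elim z)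
    then show ?case
      using weight_nonzero[of z] by (simp add: w_def)
  qed
qed

end


section \<open>Uniqueness\<close>

text \<open>After rotation by \<open>-\<i>\<close> the arc is centred at 1 and \<open>Im z\<close>
  becomes the cosine of the rotated argument; cosine is decreasing on [0, \<pi>].\<close>

lemma Im_less_cos_if_not_in_boundary_arc:
  assumes "norm z = 1" "z \<notin> boundary_arc \<alpha>" "0 \<le> \<alpha>" "\<alpha> \<le> pi"
  shows "Im z < cos \<alpha>"
proof (rule ccontr)
  assume "\<not> Im z < cos \<alpha>"
  then have ge: "cos \<alpha> \<le> Im z" by simp
  define \<theta> where "\<theta> = Arg (- \<i> * z)"
  have nz: "- \<i> * z \<noteq> 0" "norm (- \<i> * z) = 1"
    using assms(1) by (auto simp: norm_mult)
  have "- \<i> * z = cis \<theta>"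
    using Arg_eq[OF nz(1)] nz(2) by (simp add: \<theta>_def cis_conv_exp)
  then have z: "z = cis (pi / 2 + \<theta>)"
    by (simp add: complex_eq_iff cos_add sin_add)
  have "\<bar>\<theta>\<bar> \<le> pi"
    using Arg_bounded[of "- \<i> * z"] unfolding \<theta>_def abs_le_iff by linarith
  moreover have "cos \<alpha> \<le> cos \<bar>\<theta>\<bar>"
    using ge by (simp add: z sin_add)
  ultimately have "\<bar>\<theta>\<bar> \<le> \<alpha>"
    using assms(3,4) by (subst (asm) cos_mono_le_eq) auto
  then have "z \<in> boundary_arc \<alpha>"
    unfolding z boundary_arc_def by (intro imageI) (auto simp: abs_le_iff)
  with assms(2) show False by simp
qed

lemma L2_lebesgue_on_unit_disc_imp_integrable:
  assumes "L2 (lebesgue_on unit_disc) \<gamma>"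
  shows "integrable (lebesgue_on unit_disc) (\<gamma> :: complex \<Rightarrow> real)"
proof (rule Bochner_Integration.integrable_bound)
  have "finite_measure (lebesgue_on unit_disc)"
    by (auto intro!: finite_measure_lebesgue_on)
  then show "integrable (lebesgue_on unit_disc) (\<lambda>x. 1 + (\<gamma> x)\<^sup>2)"
    using assms by (intro Bochner_Integration.integrable_add finite_measure.integrable_const)
      (auto simp: L2_def)
  have "\<bar>x\<bar> \<le> 1 + x\<^sup>2" for x :: real
    using zero_le_power2[of "\<bar>x\<bar> - 1"] by (simp add: power2_eq_square algebra_simps abs_if split: if_splits)
  then show "AE x in lebesgue_on unit_disc. norm (\<gamma> x) \<le> norm (1 + (\<gamma> x)\<^sup>2)"
    by simp
qed (use assms in \<open>simp add: L2_def\<close>)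

theorem theorem3:
  fixes \<alpha> :: real and \<gamma>1 \<gamma>2 :: "complex \<Rightarrow> real"
  assumes "0 < \<alpha>" and "\<alpha> < pi/2"
    and "L2 (lebesgue_on unit_disc) \<gamma>1"
    and "L2 (lebesgue_on unit_disc) \<gamma>2"
    and "vanishes_near {cis (pi/2 - \<alpha>), cis (pi/2 + \<alpha>)} \<gamma>1"
    and "vanishes_near {cis (pi/2 - \<alpha>), cis (pi/2 + \<alpha>)} \<gamma>2"
    and "\<And>f g c1 c2. H_half_circle (zero_ext (boundary_arc \<alpha>) f) \<Longrightarrow>
           H_half_circle (zero_ext (boundary_arc \<alpha>) g) \<Longrightarrow>
           has_lin_dtn_value (boundary_arc \<alpha>) \<gamma>1 f g c1 \<Longrightarrow>
           has_lin_dtn_value (boundary_arc \<alpha>) \<gamma>2 f g c2 \<Longrightarrow> c1 = c2"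
  shows "AE x in lebesgue_on unit_disc. \<gamma>1 x = \<gamma>2 x"
proof -
  let ?M = "lebesgue_on unit_disc" and ?I = "boundary_arc \<alpha>"
  interpret arc_param "cis \<alpha>"
    using assms(1,2) by unfold_locales (auto intro: sin_gt_zero)
  note int = L2_lebesgue_on_unit_disc_imp_integrable[OF assms(3)] L2_lebesgue_on_unit_disc_imp_integrable[OF assms(4)]
  define k where "k m n z = (norm (weight z))\<^sup>2 * Re (half_map z ^ m * cnj (half_map z) ^ n)" for m n z
  \<comment> \<open>Boundedness of \<open>k m n\<close> is what lets a merely integrable coefficient
    be paired with it, so that the form has a value.\<close>
  have k_int: "integrable ?M (\<lambda>z. \<gamma> z * k m n z)" if "integrable ?M \<gamma>" for \<gamma> m n
  proof (rule integrable_mult_bounded[OF that])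
    show "k m n \<in> borel_measurable ?M"
      unfolding k_def[abs_def]
      by (intro continuous_imp_measurable_on_sets_lebesgue continuous_intros continuous_on_weight
          continuous_on_half_map) auto
    show "\<bar>k m n z\<bar> \<le> (16 / norm (1 - (cis \<alpha>)\<^sup>2))\<^sup>2 * 1" if "z \<in> space ?M" for z
    proof -
      have z: "z \<in> unit_disc" using that by simp
      then have "norm (half_map z) \<le> 1"
        using half_map_in_half_disc by (simp add: half_disc_def)
      then have "norm (half_map z ^ m * cnj (half_map z) ^ n) \<le> 1"
        by (simp add: norm_mult norm_power mult_le_one power_le_one)
      then have "\<bar>Re (half_map z ^ m * cnj (half_map z) ^ n)\<bar> \<le> 1"
        using abs_Re_le_cmod order_trans by blast
      moreover have "(norm (weight z))\<^sup>2 \<le> (16 / norm (1 - (cis \<alpha>)\<^sup>2))\<^sup>2"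
        using norm_weight[OF z] by (intro power_mono) auto
      ultimately show ?thesis
        unfolding k_def abs_mult by (intro mult_mono) auto
    qed
  qed
  have data: "\<exists>f G. H_half_circle (zero_ext ?I f) \<and> (\<exists>u. dirichlet_solution (zero_ext ?I f) u G) \<and>
      (\<forall>z\<in>unit_disc. G z = \<i> * cnj (half_map z ^ n * weight z))" for n
  proof -
    obtain F B where F: "F holomorphic_on unit_disc" "B-lipschitz_on (cball 0 1) F"
      "\<And>z. z \<in> unit_disc \<Longrightarrow> deriv F z = half_map z ^ n * weight z"
      "\<And>z. z \<in> unit_disc \<Longrightarrow> norm (deriv F z) \<le> B"
      "\<And>z. norm z = 1 \<Longrightarrow> Im z < Re (cis \<alpha>) \<Longrightarrow> Im (F z) = 0"
      using potential_extends[of n] by metis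
    let ?f = "\<lambda>z. Im (F z)"
    \<comment> \<open>The boundary values of \<open>Im F\<close> already vanish off the arc, so
      extension by zero changes nothing on the circle and creates no jump at the endpoints.\<close>
    have ext: "zero_ext ?I ?f (cis t) = Im (F (cis t))" for t
      using Im_less_cos_if_not_in_boundary_arc[of "cis t" \<alpha>] F(5)[of "cis t"] assms(1,2)
      by (auto simp: zero_ext_def)
    have "H_half_circle (zero_ext ?I ?f)"
    proof (rule H_half_circle_lipschitz)
      fix s t
      have "dist (F (cis s)) (F (cis t)) \<le> B * dist (cis s) (cis t)"
        by (rule lipschitz_onD[OF F(2)]) auto
      then show "\<bar>zero_ext ?I ?f (cis s) - zero_ext ?I ?f (cis t)\<bar> \<le> B * norm (cis s - cis t)"
        unfolding ext using abs_Im_le_cmod[of "F (cis s) - F (cis t)"] by (simp add: dist_norm)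
    qed
    moreover have "dirichlet_solution (zero_ext ?I ?f) ?f (\<lambda>z. \<i> * cnj (deriv F z))"
      by (rule dirichlet_solution_Im_holomorphic[OF F(1) lipschitz_on_continuous_on[OF F(2)] F(4) ext])
    ultimately show ?thesis
      using F(3) by (intro exI[of _ ?f] exI[of _ "\<lambda>z. \<i> * cnj (deriv F z)"]) auto
  qed
  have eq: "(\<integral>z. \<gamma>1 z * k m n z \<partial>?M) = (\<integral>z. \<gamma>2 z * k m n z \<partial>?M)" for m n
  proof -
    obtain f G u where f: "H_half_circle (zero_ext ?I f)" "dirichlet_solution (zero_ext ?I f) u G"
      "\<And>z. z \<in> unit_disc \<Longrightarrow> G z = \<i> * cnj (half_map z ^ m * weight z)"
      using data[of m] by blast
    obtain g H v where g: "H_half_circle (zero_ext ?I g)" "dirichlet_solution (zero_ext ?I g) v H"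
      "\<And>z. z \<in> unit_disc \<Longrightarrow> H z = \<i> * cnj (half_map z ^ n * weight z)"
      using data[of n] by blast
    have GH: "G z \<bullet> H z = k m n z" if "z \<in> unit_disc" for z
    proof -
      have "G z \<bullet> H z = Re ((half_map z ^ m * weight z) * cnj (half_map z ^ n * weight z))"
        unfolding f(3)[OF that] g(3)[OF that] by (rule inner_i_cnj_i_cnj)
      also have "(half_map z ^ m * weight z) * cnj (half_map z ^ n * weight z)
          = of_real ((norm (weight z))\<^sup>2) * (half_map z ^ m * cnj (half_map z) ^ n)"
        unfolding complex_norm_square by simp
      also have "Re \<dots> = k m n z"
        by (simp only: k_def scaleR_conv_of_real[symmetric] scaleR_complex.sel)
      finally show ?thesis .
    qed
    \<comment> \<open>The hypothesis compares values only where both exist. The same solutions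
      \<open>u\<close> and \<open>v\<close> serve for either coefficient and provide this
      existence.\<close>
    have val: "has_lin_dtn_value ?I \<gamma> f g (\<integral>z. \<gamma> z * k m n z \<partial>?M)" if "integrable ?M \<gamma>" for \<gamma>
    proof -
      have "has_bochner_integral ?M (\<lambda>z. \<gamma> z * k m n z) (\<integral>z. \<gamma> z * k m n z \<partial>?M)"
        using k_int[OF that] by (simp add: has_bochner_integral_iff)
      also have "has_bochner_integral ?M (\<lambda>z. \<gamma> z * k m n z) (\<integral>z. \<gamma> z * k m n z \<partial>?M) \<longleftrightarrow>
          has_bochner_integral ?M (\<lambda>z. \<gamma> z * (G z \<bullet> H z)) (\<integral>z. \<gamma> z * k m n z \<partial>?M)"
        by (intro has_bochner_integral_cong) (auto simp: GH)
      finally show ?thesis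
        unfolding has_lin_dtn_value_def using f(2) g(2) by blast
    qed
    show ?thesis
      by (rule assms(7)[OF f(1) g(1) val[OF int(1)] val[OF int(2)]])
  qed
  have "AE z in ?M. \<gamma>1 z - \<gamma>2 z = 0"
  proof (rule AE_eq_0_if_moments_eq_0)
    show "integrable ?M (\<lambda>z. \<gamma>1 z - \<gamma>2 z)"
      using int by simp
    show "(\<integral>z. (\<gamma>1 z - \<gamma>2 z) * ((norm (weight z))\<^sup>2 * Re (half_map z ^ m * cnj (half_map z) ^ n)) \<partial>?M) = 0"
      for m n
      unfolding k_def[symmetric] left_diff_distrib
      using eq[of m n] k_int[OF int(1), of m n] k_int[OF int(2), of m n] by simp
  qed
  then show ?thesis
    by simp
qed

end
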